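(* Let $A=\mathbb K[x]$ and $B=\mathbb K[y]$. Suppose that $\tau:B\otimes A\to A\otimes B$ is a graded twisting map and write $\tau(y\otimes x)=a\,x^2\otimes 1+b\,x\otimes y+1\otimes c\,y^2$ with $a,b,c\in\mathbb K$. If $1-ac\neq 0$ and ($b\neq 0$ or $c\neq 0$), then $\tau$ has the unique extension property and $A\otimes_\tau B$ is quadratic, hence Koszul.
   Context: $\mathbb K$ is a field, $\otimes=\otimes_{\mathbb K}$; $x,y$ have degree $1$. $\mu_A$ is the multiplication of $A$; $1_A$ also denotes the identity map of $A$. Tensor products of graded spaces are graded by $(V\otimes W)_m=\bigoplus_{k+l=m}V_k\otimes W_l$. A linear map is graded if it preserves degree; $f_n$ is its degree $n$ component, $f_{\le n}=\bigoplus_{i\le n}f_i$. A graded twisting map is a graded linear map $\tau:B\otimes A\to A\otimes B$ with $\tau(1_B\otimes a)=a\otimes 1_B$, $\tau(b\otimes 1_A)=1_A\otimes b$ and $\tau(\mu_B\otimes\mu_A)=(\mu_A\otimes\mu_B)(1_A\otimes\tau\otimes 1_B)(\tau\otimes\tau)(1_B\otimes\tau\otimes 1_A)$ on $B\otimes B\otimes A\otimes A$. Then $A\otimes_\tau B$ is the graded associative algebra with underlying space $A\otimes B$ and multiplication $(\mu_A\otimes\mu_B)(1_A\otimes\tau\otimes 1_B)$. A graded linear map $t:(B\otimes A)_{\le n}\to(A\otimes B)_{\le n}$ is graded twisting to degree $n$ if for each $i\le n$: $t(1_B\otimes a)=a\otimes 1_B$, $t(b\otimes 1_A)=1_A\otimes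 b$ for $a\in A_i$, $b\in B_i$, and $t_i(\mu_B\otimes\mu_A)=(\mu_A\otimes\mu_B)(1_A\otimes t_{\le i}\otimes 1_B)(t_{\le i}\otimes t_{\le i})(1_B\otimes t_{\le i}\otimes 1_A)$ on $(B\otimes B\otimes A\otimes A)_i$. A graded linear map $B\otimes A\to A\otimes B$ is graded twisting to degree $n$ if its restriction to $(B\otimes A)_{\le n}$ is. A graded twisting map $\tau$ has the unique extension property if for every $n\ge 3$ and every graded linear map $\tau':B\otimes A\to A\otimes B$ that is graded twisting to degree $n$ and satisfies $\tau'_i=\tau_i$ for all $i<n$, one has $\tau'_n=\tau_n$. A connected graded algebra $C$ is quadratic if $\pi:T(C_1)\to C$ is surjective with kernel generated as a two-sided ideal by $\ker\pi\cap(C_1\otimes C_1)$; it is Koszul if $\mathbb K=C/C_{+}$ has a resolution by graded free left $C$-modules $P_i$ generated in degree $i$. *)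

theory Defs
  imports Complex_Main "HOL-Library.Poly_Mapping"
begin

text \<open>
  A vector space over a field \<open>'k\<close> is given together with a basis indexed by a type \<open>'i\<close>, i.e. it
  is the space \<open>'i \<Rightarrow>\<^sub>0 'k\<close> of finitely supported functions, \<open>single i 1\<close> being the basis vectors.
  Since every (graded) vector space has a (homogeneous) basis, this is no loss of generality, and
  \<open>V \<otimes> W\<close> is the space whose basis is indexed by the pairs of basis indices.
\<close>

abbreviation lookup :: "('i \<Rightarrow>\<^sub>0 'k::zero) \<Rightarrow> 'i \<Rightarrow> 'k" where "lookup \<equiv> Poly_Mapping.lookup"
abbreviation keys :: "('i \<Rightarrow>\<^sub>0 'k::zero) \<Rightarrow> 'i set" where "keys \<equiv> Poly_Mapping.keys"
abbreviation single :: "'i \<Rightarrow> 'k \<Rightarrow> ('i \<Rightarrow>\<^sub>0 'k::zero)" where "single \<equiv> Poly_Mapping.single"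

definition scale :: "'k::field \<Rightarrow> ('i \<Rightarrow>\<^sub>0 'k) \<Rightarrow> ('i \<Rightarrow>\<^sub>0 'k)"  (infixr \<open>*\<^sub>k\<close> 75)
  where "c *\<^sub>k v = Poly_Mapping.map ((*) c) v"

lemma lookup_scale [simp]: "lookup (c *\<^sub>k v) i = c * lookup v i"
  by (simp add: scale_def Poly_Mapping.map.rep_eq when_def)

lemma vector_space_scale: "vector_space (scale :: 'k::field \<Rightarrow> ('i \<Rightarrow>\<^sub>0 'k) \<Rightarrow> _)"
  by unfold_locales (auto intro!: poly_mapping_eqI simp: lookup_add algebra_simps)

abbreviation lin :: "(('i \<Rightarrow>\<^sub>0 'k::field) \<Rightarrow> ('j \<Rightarrow>\<^sub>0 'k)) \<Rightarrow> bool"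
  where "lin f \<equiv> Vector_Spaces.linear scale scale f"

definition lin_ext :: "('i \<Rightarrow> ('j \<Rightarrow>\<^sub>0 'k)) \<Rightarrow> ('i \<Rightarrow>\<^sub>0 'k::field) \<Rightarrow> ('j \<Rightarrow>\<^sub>0 'k)"
  where "lin_ext \<phi> v = (\<Sum>i\<in>keys v. lookup v i *\<^sub>k \<phi> i)"

definition coord_space :: "'i set \<Rightarrow> ('i \<Rightarrow>\<^sub>0 'k::field) set"
  where "coord_space X = {v. keys v \<subseteq> X}"

definition coord_proj :: "'i set \<Rightarrow> ('i \<Rightarrow>\<^sub>0 'k::field) \<Rightarrow> ('i \<Rightarrow>\<^sub>0 'k)"
  where "coord_proj X = Poly_Mapping.mapp (\<lambda>i c. c when i \<in> X)"


subsection \<open>Tensor products\<close>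

definition tensor :: "('i \<Rightarrow>\<^sub>0 'k::field) \<Rightarrow> ('j \<Rightarrow>\<^sub>0 'k) \<Rightarrow> ('i \<times> 'j \<Rightarrow>\<^sub>0 'k)"  (infixl \<open>\<otimes>\<close> 70)
  where "v \<otimes> w = lin_ext (\<lambda>i. lin_ext (\<lambda>j. single (i, j) 1) w) v"

lemma lookup_tensor: "lookup (v \<otimes> w) (i, j) = lookup v i * lookup w j"
proof -
  have "lookup (v \<otimes> w) (i, j) =
      (\<Sum>i'\<in>keys v. \<Sum>j'\<in>keys w. lookup v i' * (lookup w j' * (1 when i' = i \<and> j' = j)))"
    by (simp add: tensor_def lin_ext_def lookup_sum lookup_single sum_distrib_left)
  also have "\<dots> = (\<Sum>i'\<in>keys v. if i' = i then lookup v i * lookup w j else 0)"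
    by (intro sum.cong refl) (auto simp: when_def if_distrib sum.delta in_keys_iff cong: if_cong)
  also have "\<dots> = lookup v i * lookup w j"
    by (simp add: sum.delta in_keys_iff)
  finally show ?thesis .
qed

definition tensor_map ::
  "(('i \<Rightarrow>\<^sub>0 'k::field) \<Rightarrow> ('p \<Rightarrow>\<^sub>0 'k)) \<Rightarrow> (('j \<Rightarrow>\<^sub>0 'k) \<Rightarrow> ('q \<Rightarrow>\<^sub>0 'k)) \<Rightarrow>
   ('i \<times> 'j \<Rightarrow>\<^sub>0 'k) \<Rightarrow> ('p \<times> 'q \<Rightarrow>\<^sub>0 'k)"  (infixl \<open>\<Otimes>\<close> 70)
  where "f \<Otimes> g = lin_ext (\<lambda>(i, j). f (single i 1) \<otimes> g (single j 1))"

text \<open>The map \<open>1 \<otimes> f \<otimes> 1\<close> on a four-fold tensor product bracketed as \<open>(P \<otimes> V) \<otimes> (W \<otimes> S)\<close>, where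
  \<open>f : V \<otimes> W \<rightarrow> V' \<otimes> W'\<close>; the result is bracketed as \<open>(P \<otimes> V') \<otimes> (W' \<otimes> S)\<close>.\<close>

definition mid_map ::
  "(('v \<times> 'w \<Rightarrow>\<^sub>0 'k::field) \<Rightarrow> ('v' \<times> 'w' \<Rightarrow>\<^sub>0 'k)) \<Rightarrow>
   (('p \<times> 'v) \<times> ('w \<times> 's) \<Rightarrow>\<^sub>0 'k) \<Rightarrow> (('p \<times> 'v') \<times> ('w' \<times> 's) \<Rightarrow>\<^sub>0 'k)"
  where "mid_map f =
     lin_ext (\<lambda>(p, ((v, w), s)). single ((p, v), (w, s)) 1)
     \<circ> (id \<Otimes> (f \<Otimes> id))
     \<circ> lin_ext (\<lambda>((p, v), (w, s)). single (p, ((v, w), s)) 1)"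

definition tensor_deg :: "('i \<Rightarrow> nat) \<Rightarrow> ('j \<Rightarrow> nat) \<Rightarrow> 'i \<times> 'j \<Rightarrow> nat"
  where "tensor_deg d e = (\<lambda>(i, j). d i + e j)"


subsection \<open>Gradings\<close>

text \<open>A grading is given by the degrees of the basis vectors.\<close>

definition homog :: "('i \<Rightarrow> nat) \<Rightarrow> nat \<Rightarrow> ('i \<Rightarrow>\<^sub>0 'k::field) set"
  where "homog d n = coord_space {i. d i = n}"

definition graded_linear_map ::
  "('i \<Rightarrow> nat) \<Rightarrow> ('j \<Rightarrow> nat) \<Rightarrow> (('i \<Rightarrow>\<^sub>0 'k::field) \<Rightarrow> ('j \<Rightarrow>\<^sub>0 'k)) \<Rightarrow> bool"
  where "graded_linear_map d e f \<longleftrightarrow> lin f \<and> (\<forall>n. f ` homog d n \<subseteq> homog e n)"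

text \<open>The components \<open>f\<^sub>n\<close> and \<open>f\<^sub>\<le>\<^sub>n\<close> of a graded linear map, extended by zero to the other degrees.\<close>

definition deg_eq :: "('i \<Rightarrow> nat) \<Rightarrow> nat \<Rightarrow> (('i \<Rightarrow>\<^sub>0 'k::field) \<Rightarrow> ('j \<Rightarrow>\<^sub>0 'k)) \<Rightarrow> ('i \<Rightarrow>\<^sub>0 'k) \<Rightarrow> ('j \<Rightarrow>\<^sub>0 'k)"
  where "deg_eq d n f = f \<circ> coord_proj {i. d i = n}"

definition deg_le :: "('i \<Rightarrow> nat) \<Rightarrow> nat \<Rightarrow> (('i \<Rightarrow>\<^sub>0 'k::field) \<Rightarrow> ('j \<Rightarrow>\<^sub>0 'k)) \<Rightarrow> ('i \<Rightarrow>\<^sub>0 'k) \<Rightarrow> ('j \<Rightarrow>\<^sub>0 'k)"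
  where "deg_le d n f = f \<circ> coord_proj {i. d i \<le> n}"


subsection \<open>Graded algebras\<close>

record (overloaded) ('i, 'k::zero) galg =
  gdeg :: "'i \<Rightarrow> nat"
  gmult :: "('i \<times> 'i \<Rightarrow>\<^sub>0 'k) \<Rightarrow> ('i \<Rightarrow>\<^sub>0 'k)"
  gone :: "'i \<Rightarrow>\<^sub>0 'k"

definition graded_algebra :: "('i, 'k::field) galg \<Rightarrow> bool"
  where "graded_algebra C \<longleftrightarrow>
     graded_linear_map (tensor_deg (gdeg C) (gdeg C)) (gdeg C) (gmult C) \<and>
     gone C \<in> homog (gdeg C) 0 \<and>
     (\<forall>u v w. gmult C (gmult C (u \<otimes> v) \<otimes> w) = gmult C (u \<otimes> gmult C (v \<otimes> w))) \<and>
     (\<forall>v. gmult C (gone C \<otimes> v) = v \<and> gmult C (v \<otimes> gone C) = v)"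

definition connected_graded_algebra :: "('i, 'k::field) galg \<Rightarrow> bool"
  where "connected_graded_algebra C \<longleftrightarrow>
     graded_algebra C \<and> gone C \<noteq> 0 \<and> homog (gdeg C) 0 = {c *\<^sub>k gone C |c. True}"

text \<open>The polynomial algebra in one variable of degree \<open>1\<close>: \<open>single n 1\<close> is the \<open>n\<close>-th power of the
  variable, and \<open>nat \<Rightarrow>\<^sub>0 'k\<close> carries the library's (convolution) multiplication of polynomials.\<close>

definition polynomial_algebra :: "(nat, 'k::field) galg"
  where "polynomial_algebra =
     \<lparr>gdeg = id, gmult = lin_ext (\<lambda>(i, j). single i 1 * single j 1), gone = 1\<rparr>"

lemma gmult_polynomial_algebra: "gmult polynomial_algebra (p \<otimes> q) = p * q"
proof -
  have expand: "r = (\<Sum>i\<in>keys r. single i (lookup r i))" for r :: "nat \<Rightarrow>\<^sub>0 'a"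
    by (intro poly_mapping_eqI) (simp add: lookup_sum lookup_single when_def in_keys_iff)
  have ks: "keys (p \<otimes> q) = keys p \<times> keys q"
    by (auto simp: in_keys_iff lookup_tensor)
  have sc: "c *\<^sub>k single k 1 = single k c" for c :: 'a and k :: nat
    by (intro poly_mapping_eqI) (simp add: lookup_single when_def)
  have "gmult polynomial_algebra (p \<otimes> q) =
      (\<Sum>i\<in>keys p. \<Sum>j\<in>keys q. single i (lookup p i) * single j (lookup q j))"
    by (auto simp: polynomial_algebra_def lin_ext_def ks lookup_tensor mult_single sc
        sum.cartesian_product intro!: sum.cong)
  also have "\<dots> = p * q"
    by (subst (3) expand, subst (4) expand) (simp add: sum_product)
  finally show ?thesis .
qed

definition indet :: "nat \<Rightarrow>\<^sub>0 'k::field"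
  where "indet = single 1 1"


subsection \<open>Graded twisting maps\<close>

text \<open>A map \<open>\<tau> : B \<otimes> A \<rightarrow> A \<otimes> B\<close>; the source \<open>B \<otimes> B \<otimes> A \<otimes> A\<close> of the last condition is bracketed
  as \<open>(B \<otimes> B) \<otimes> (A \<otimes> A)\<close>.\<close>

definition graded_twisting_map ::
  "('i, 'k::field) galg \<Rightarrow> ('j, 'k) galg \<Rightarrow> (('j \<times> 'i \<Rightarrow>\<^sub>0 'k) \<Rightarrow> ('i \<times> 'j \<Rightarrow>\<^sub>0 'k)) \<Rightarrow> bool"
  where "graded_twisting_map A B \<tau> \<longleftrightarrow>
     graded_linear_map (tensor_deg (gdeg B) (gdeg A)) (tensor_deg (gdeg A) (gdeg B)) \<tau> \<and>
     (\<forall>a. \<tau> (gone B \<otimes> a) = a \<otimes> gone B) \<and>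
     (\<forall>b. \<tau> (b \<otimes> gone A) = gone A \<otimes> b) \<and>
     \<tau> \<circ> (gmult B \<Otimes> gmult A) =
       (gmult A \<Otimes> gmult B) \<circ> mid_map \<tau> \<circ> (\<tau> \<Otimes> \<tau>) \<circ> mid_map \<tau>"

definition twisted_tensor_product ::
  "('i, 'k::field) galg \<Rightarrow> ('j, 'k) galg \<Rightarrow> (('j \<times> 'i \<Rightarrow>\<^sub>0 'k) \<Rightarrow> ('i \<times> 'j \<Rightarrow>\<^sub>0 'k)) \<Rightarrow>
   ('i \<times> 'j, 'k) galg"
  where "twisted_tensor_product A B \<tau> =
     \<lparr>gdeg = tensor_deg (gdeg A) (gdeg B),
      gmult = (gmult A \<Otimes> gmult B) \<circ> mid_map \<tau>,
      gone = gone A \<otimes> gone B\<rparr>"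

text \<open>Only the restriction of \<open>t\<close> to degrees at most \<open>n\<close> enters the last three conditions: on
  tensors of degree \<open>i \<le> n\<close> all the maps involved see components of degree at most \<open>i\<close> only.\<close>

definition graded_twisting_to_degree ::
  "('i, 'k::field) galg \<Rightarrow> ('j, 'k) galg \<Rightarrow> nat \<Rightarrow>
   (('j \<times> 'i \<Rightarrow>\<^sub>0 'k) \<Rightarrow> ('i \<times> 'j \<Rightarrow>\<^sub>0 'k)) \<Rightarrow> bool"
  where "graded_twisting_to_degree A B n t \<longleftrightarrow>
     graded_linear_map (tensor_deg (gdeg B) (gdeg A)) (tensor_deg (gdeg A) (gdeg B)) t \<and>
     (\<forall>i\<le>n.
        let dBA = tensor_deg (gdeg B) (gdeg A);
            t_le = deg_le dBA i t
        in (\<forall>a\<in>homog (gdeg A) i. t (gone B \<otimes> a) = a \<otimes> gone B) \<and>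
           (\<forall>b\<in>homog (gdeg B) i. t (b \<otimes> gone A) = gone A \<otimes> b) \<and>
           (\<forall>v\<in>homog (tensor_deg (tensor_deg (gdeg B) (gdeg B)) (tensor_deg (gdeg A) (gdeg A))) i.
              deg_eq dBA i t ((gmult B \<Otimes> gmult A) v) =
              ((gmult A \<Otimes> gmult B) \<circ> mid_map t_le \<circ> (t_le \<Otimes> t_le) \<circ> mid_map t_le) v))"

definition unique_extension_property ::
  "('i, 'k::field) galg \<Rightarrow> ('j, 'k) galg \<Rightarrow> (('j \<times> 'i \<Rightarrow>\<^sub>0 'k) \<Rightarrow> ('i \<times> 'j \<Rightarrow>\<^sub>0 'k)) \<Rightarrow> bool"
  where "unique_extension_property A B \<tau> \<longleftrightarrow>
     (let dBA = tensor_deg (gdeg B) (gdeg A)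
      in \<forall>n\<ge>3. \<forall>\<tau>'.
           graded_linear_map dBA (tensor_deg (gdeg A) (gdeg B)) \<tau>' \<longrightarrow>
           graded_twisting_to_degree A B n \<tau>' \<longrightarrow>
           (\<forall>i<n. deg_eq dBA i \<tau>' = deg_eq dBA i \<tau>) \<longrightarrow>
           deg_eq dBA n \<tau>' = deg_eq dBA n \<tau>)"


subsection \<open>Quadratic algebras\<close>

text \<open>The basis vectors of \<open>C\<close> of degree \<open>1\<close> form a basis of \<open>C\<^sub>1\<close>, so the words in their indices
  index the induced basis of the tensor algebra \<open>T(C\<^sub>1)\<close>, with concatenation as multiplication; the
  words of length \<open>n\<close> span the \<open>n\<close>-th tensor power of \<open>C\<^sub>1\<close>.\<close>

definition tensor_algebra :: "('i, 'k::field) galg \<Rightarrow> ('i list \<Rightarrow>\<^sub>0 'k) set"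
  where "tensor_algebra C = coord_space (lists {i. gdeg C i = 1})"

definition word_mult :: "('i list \<Rightarrow>\<^sub>0 'k::field) \<Rightarrow> ('i list \<Rightarrow>\<^sub>0 'k) \<Rightarrow> ('i list \<Rightarrow>\<^sub>0 'k)"
  where "word_mult u v = lin_ext (\<lambda>(p, q). single (p @ q) 1) (u \<otimes> v)"

definition word_eval :: "('i, 'k::field) galg \<Rightarrow> ('i list \<Rightarrow>\<^sub>0 'k) \<Rightarrow> ('i \<Rightarrow>\<^sub>0 'k)"
  where "word_eval C = lin_ext (\<lambda>w. foldr (\<lambda>i v. gmult C (single i 1 \<otimes> v)) w (gone C))"

definition two_sided_ideal :: "('i, 'k::field) galg \<Rightarrow> ('i list \<Rightarrow>\<^sub>0 'k) set \<Rightarrow> bool"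
  where "two_sided_ideal C I \<longleftrightarrow>
     I \<subseteq> tensor_algebra C \<and> module.subspace scale I \<and>
     (\<forall>u\<in>tensor_algebra C. \<forall>v\<in>I. word_mult u v \<in> I \<and> word_mult v u \<in> I)"

definition quadratic_algebra :: "('i, 'k::field) galg \<Rightarrow> bool"
  where "quadratic_algebra C \<longleftrightarrow>
     connected_graded_algebra C \<and>
     word_eval C ` tensor_algebra C = UNIV \<and>
     (let K = {u \<in> tensor_algebra C. word_eval C u = 0}
      in K = two_sided_ideal C hull (K \<inter> homog length 2))"


subsection \<open>Koszul algebras\<close>

text \<open>The graded free left \<open>C\<close>-module with a basis \<open>S \<subseteq> 's\<close> placed in degree \<open>n\<close> is \<open>C \<otimes> V\<close>, where \<open>V\<close>
  is the space with basis \<open>S\<close>; inside \<open>'i \<times> 's \<Rightarrow>\<^sub>0 'k\<close> it is spanned by the indices in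
  \<open>UNIV \<times> S\<close>, and \<open>C\<close> acts by its multiplication on the left factor.\<close>

definition free_act ::
  "('i, 'k::field) galg \<Rightarrow> ('i \<Rightarrow>\<^sub>0 'k) \<Rightarrow> ('i \<times> 's \<Rightarrow>\<^sub>0 'k) \<Rightarrow> ('i \<times> 's \<Rightarrow>\<^sub>0 'k)"
  where "free_act C c p =
     (gmult C \<Otimes> id) (lin_ext (\<lambda>(i, (j, s)). single ((i, j), s) 1) (c \<otimes> p))"

definition free_deg :: "('i, 'k::field) galg \<Rightarrow> nat \<Rightarrow> 'i \<times> 's \<Rightarrow> nat"
  where "free_deg C n = tensor_deg (gdeg C) (\<lambda>_. n)"

text \<open>The residue module \<open>C/C\<^sub>+\<close>, identified with its set \<open>C\<^sub>0\<close> of representatives.\<close>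

definition residue_act :: "('i, 'k::field) galg \<Rightarrow> ('i \<Rightarrow>\<^sub>0 'k) \<Rightarrow> ('i \<Rightarrow>\<^sub>0 'k) \<Rightarrow> ('i \<Rightarrow>\<^sub>0 'k)"
  where "residue_act C c v = coord_proj {i. gdeg C i = 0} (gmult C (c \<otimes> v))"

text \<open>Homomorphisms of graded left modules, whose underlying spaces are spanned by the index sets
  \<open>X\<close> and \<open>Y\<close> with degree functions \<open>d\<close> and \<open>e\<close>. Linearity over the field follows from
  \<open>C\<close>-linearity.\<close>

definition graded_module_hom ::
  "(('i \<Rightarrow>\<^sub>0 'k::field) \<Rightarrow> ('x \<Rightarrow>\<^sub>0 'k) \<Rightarrow> ('x \<Rightarrow>\<^sub>0 'k)) \<Rightarrow> 'x set \<Rightarrow> ('x \<Rightarrow> nat) \<Rightarrow>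
   (('i \<Rightarrow>\<^sub>0 'k) \<Rightarrow> ('y \<Rightarrow>\<^sub>0 'k) \<Rightarrow> ('y \<Rightarrow>\<^sub>0 'k)) \<Rightarrow> 'y set \<Rightarrow> ('y \<Rightarrow> nat) \<Rightarrow>
   (('x \<Rightarrow>\<^sub>0 'k) \<Rightarrow> ('y \<Rightarrow>\<^sub>0 'k)) \<Rightarrow> bool"
  where "graded_module_hom act X d act' Y e f \<longleftrightarrow>
     (\<forall>p\<in>coord_space X. \<forall>q\<in>coord_space X. f (p + q) = f p + f q) \<and>
     (\<forall>c. \<forall>p\<in>coord_space X. f (act c p) = act' c (f p)) \<and>
     (\<forall>m. f ` coord_space {x\<in>X. d x = m} \<subseteq> coord_space {y\<in>Y. e y = m})"

text \<open>A resolution \<open>\<cdots> \<rightarrow> P\<^sub>2 \<rightarrow> P\<^sub>1 \<rightarrow> P\<^sub>0 \<rightarrow> C/C\<^sub>+ \<rightarrow> 0\<close> with \<open>P\<^sub>n\<close> graded free on a set \<open>S n\<close> in degree \<open>n\<close>,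
  with differentials \<open>\<delta> n : P\<^sub>n\<^sub>+\<^sub>1 \<rightarrow> P\<^sub>n\<close> and augmentation \<open>\<epsilon>\<close>. Labelling the generators by words in the
  basis indices of \<open>C\<close> is no restriction: such a resolution is minimal, so \<open>S n\<close> has the cardinality
  of a basis of \<open>Tor\<^sub>n(K, K)\<close>, which embeds in the \<open>n\<close>-th tensor power of \<open>C\<^sub>+\<close>.\<close>

definition koszul_algebra :: "('i, 'k::field) galg \<Rightarrow> bool"
  where "koszul_algebra C \<longleftrightarrow>
     connected_graded_algebra C \<and>
     (\<exists>(S :: nat \<Rightarrow> 'i list set) (\<delta> :: nat \<Rightarrow> ('i \<times> 'i list \<Rightarrow>\<^sub>0 'k) \<Rightarrow> ('i \<times> 'i list \<Rightarrow>\<^sub>0 'k))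
       (\<epsilon> :: ('i \<times> 'i list \<Rightarrow>\<^sub>0 'k) \<Rightarrow> ('i \<Rightarrow>\<^sub>0 'k)).
        let P = \<lambda>n. coord_space (UNIV \<times> S n)
        in (\<forall>n. graded_module_hom
                  (free_act C) (UNIV \<times> S (Suc n)) (free_deg C (Suc n))
                  (free_act C) (UNIV \<times> S n) (free_deg C n) (\<delta> n)) \<and>
           graded_module_hom
             (free_act C) (UNIV \<times> S 0) (free_deg C 0)
             (residue_act C) {i. gdeg C i = 0} (gdeg C) \<epsilon> \<and>
           \<epsilon> ` P 0 = homog (gdeg C) 0 \<and>
           {p \<in> P 0. \<epsilon> p = 0} = \<delta> 0 ` P 1 \<and>
           (\<forall>n. {p \<in> P (Suc n). \<delta> n p = 0} = \<delta> (Suc n) ` P (Suc (Suc n))))"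

end

theory Submission
  imports Defs
begin

text \<open>
  Write \<open>u = y - a x\<close> and \<open>s = b x + c y\<close>, so that the relation of \<open>C = A \<otimes>\<^sub>\<tau> B\<close> in degree two reads
  \<open>u x = s y\<close>. The coefficient \<open>t\<^sub>j\<close> of \<open>y\<^sup>j\<^sup>+\<^sup>1\<close> in \<open>y\<^sup>j x\<close> satisfies \<open>t\<^sub>0 = 0\<close> and
  \<open>t\<^sub>j\<^sub>+\<^sub>1 (1 - a t\<^sub>j) = c + b t\<^sub>j\<close>, and \<open>1 - a c \<noteq> 0\<close> forces \<open>1 - a t\<^sub>j \<noteq> 0\<close> for all \<open>j\<close>.
  Since \<open>x\<^sup>i y\<^sup>j u = (1 - a t\<^sub>j) x\<^sup>i y\<^sup>j\<^sup>+\<^sup>1\<close> plus terms with more factors \<open>x\<close>, right multiplication by \<open>u\<close>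
  is injective and \<open>C = K[x] + C u\<close>. Hence \<open>p x + q y = 0\<close> holds only for \<open>p = w u\<close>, \<open>q = - w s\<close>: all
  relations of \<open>C\<close> follow from the quadratic one, and \<open>0 \<rightarrow> C(-2) \<rightarrow> C(-1)\<^sup>2 \<rightarrow> C\<close> is a linear resolution
  of \<open>K\<close>. If \<open>\<tau>'\<close> extends \<open>\<tau>\<close> from degrees below \<open>n\<close>, then \<open>\<tau>' - \<tau>\<close> is determined in degree \<open>n\<close> by its
  value \<open>G\<close> on \<open>y\<^sup>n\<^sup>-\<^sup>1 \<otimes> x\<close>, and computing \<open>y\<^sup>n\<^sup>-\<^sup>2 \<cdot> y x\<close> in two ways gives \<open>(1 - a t\<^sub>n\<^sub>-\<^sub>2) G = 0\<close>.
\<close>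

section \<open>Linear maps in coordinates\<close>

lemma scale_simps [simp]:
  fixes u v :: "'i \<Rightarrow>\<^sub>0 'k::field"
  shows "0 *\<^sub>k v = 0" "1 *\<^sub>k v = v" "r *\<^sub>k (0 :: 'i \<Rightarrow>\<^sub>0 'k) = 0"
    "r *\<^sub>k s *\<^sub>k v = (r * s) *\<^sub>k v"
    "r *\<^sub>k single i s = single i (r * s)"
  by (auto intro!: poly_mapping_eqI simp: lookup_single when_def algebra_simps)

lemma scale_distribs:
  fixes u v :: "'i \<Rightarrow>\<^sub>0 'k::field"
  shows "r *\<^sub>k (u + v) = r *\<^sub>k u + r *\<^sub>k v" "r *\<^sub>k (u - v) = r *\<^sub>k u - r *\<^sub>k v"
    "(r + s) *\<^sub>k v = r *\<^sub>k v + s *\<^sub>k v" "(r - s) *\<^sub>k v = r *\<^sub>k v - s *\<^sub>k v"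
    "r *\<^sub>k (- v) = - (r *\<^sub>k v)" "(- r) *\<^sub>k v = - (r *\<^sub>k v)"
  by (auto intro!: poly_mapping_eqI simp: lookup_add lookup_minus algebra_simps)

lemma scale_sum: "r *\<^sub>k sum f X = (\<Sum>i\<in>X. r *\<^sub>k f i)"
  by (induction X rule: infinite_finite_induct) (auto simp: scale_distribs)

lemma lin_iff:
  "lin f \<longleftrightarrow> (\<forall>u v. f (u + v) = f u + f v) \<and> (\<forall>r v. f (r *\<^sub>k v) = r *\<^sub>k f v)"
  by (simp add: Vector_Spaces.linear_iff vector_space_scale)

context
  fixes f :: "('i \<Rightarrow>\<^sub>0 'k::field) \<Rightarrow> ('j \<Rightarrow>\<^sub>0 'k)"
  assumes f: "lin f"
begin

lemma lin_add: "f (u + v) = f u + f v"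
  and lin_scale: "f (r *\<^sub>k v) = r *\<^sub>k f v"
  using f by (auto simp: lin_iff)

lemma lin_zero: "f 0 = 0"
  using lin_scale[of 0 0] by simp

lemma lin_minus: "f (- v) = - f v"
  using lin_scale[of "- 1" v] by (simp add: scale_distribs)

lemma lin_diff: "f (u - v) = f u - f v"
  using lin_add[of u "- v"] by (simp add: lin_minus)

lemma lin_sum: "f (sum g X) = (\<Sum>i\<in>X. f (g i))"
  by (induction X rule: infinite_finite_induct) (auto simp: lin_zero lin_add)

end

lemma expand_basis: "v = (\<Sum>i\<in>keys v. lookup v i *\<^sub>k single i 1)"
  by (intro poly_mapping_eqI) (simp add: lookup_sum lookup_single when_def in_keys_iff)

text \<open>Agreement is asked only on the basis vectors in the support of \<open>v\<close>, so that
  a support condition on \<open>v\<close> can be used in verifying it.\<close>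

lemma lin_eqI:
  assumes "lin f" "lin g" "\<And>i. i \<in> keys v \<Longrightarrow> f (single i 1) = g (single i 1)"
  shows "f v = g v"
proof -
  have "f v = (\<Sum>i\<in>keys v. lookup v i *\<^sub>k f (single i 1))"
    by (subst expand_basis) (simp add: lin_sum[OF assms(1)] lin_scale[OF assms(1)] del: scale_simps)
  also have "\<dots> = (\<Sum>i\<in>keys v. lookup v i *\<^sub>k g (single i 1))"
    by (intro sum.cong refl) (simp add: assms(3))
  also have "\<dots> = g v"
    by (subst (3) expand_basis) (simp add: lin_sum[OF assms(2)] lin_scale[OF assms(2)] del: scale_simps)
  finally show ?thesis .
qed

lemma lin_eq:
  assumes "lin f" "lin g" "\<And>i. f (single i 1) = g (single i 1)"
  shows "f = g"
  by (rule ext, rule lin_eqI[OF assms])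

text \<open>Summing over a larger finite index set allows two vectors to be expanded over a common
  set, as additivity requires.\<close>

lemma lin_ext_superset:
  assumes "finite X" "keys v \<subseteq> X"
  shows "lin_ext \<phi> v = (\<Sum>i\<in>X. lookup v i *\<^sub>k \<phi> i)"
  unfolding lin_ext_def using assms
  by (intro sum.mono_neutral_left) (auto simp: in_keys_iff)

lemma lin_lin_ext [simp]: "lin (lin_ext \<phi>)"
proof -
  have "lin_ext \<phi> (u + v) = lin_ext \<phi> u + lin_ext \<phi> v" for u v
  proof -
    have fin: "finite (keys u \<union> keys v)" and sub: "keys (u + v) \<subseteq> keys u \<union> keys v"
      by (auto simp: keys_add)
    show ?thesis
      by (simp add: lin_ext_superset[OF fin sub] lin_ext_superset[OF fin, of u]
          lin_ext_superset[OF fin, of v] lookup_add scale_distribs sum.distrib)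
  qed
  moreover have "lin_ext \<phi> (r *\<^sub>k v) = r *\<^sub>k lin_ext \<phi> v" for r v
  proof -
    have "keys (r *\<^sub>k v) \<subseteq> keys v"
      by (auto simp: in_keys_iff)
    then show ?thesis
      by (simp add: lin_ext_superset[of "keys v"] scale_sum)
  qed
  ultimately show ?thesis
    by (simp add: lin_iff)
qed

lemma lin_ext_single [simp]: "lin_ext \<phi> (single i 1) = \<phi> i"
  by (simp add: lin_ext_def lookup_single)

lemma lin_ext_lin:
  assumes "lin f"
  shows "f v = lin_ext (\<lambda>i. f (single i 1)) v"
  by (rule lin_eqI[OF assms]) auto

lemma lin_comp: "lin f \<Longrightarrow> lin g \<Longrightarrow> lin (\<lambda>v. f (g v))"
  by (simp add: lin_iff)

lemma lin_o: "lin f \<Longrightarrow> lin g \<Longrightarrow> lin (f \<circ> g)"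
  by (simp add: lin_iff)

lemma lin_id [simp]: "lin (\<lambda>v. v)"
  by (simp add: lin_iff)

lemma lin_plus: "lin f \<Longrightarrow> lin g \<Longrightarrow> lin (\<lambda>v. f v + g v)"
  by (simp add: lin_iff scale_distribs)

lemma lin_minus_fun: "lin f \<Longrightarrow> lin g \<Longrightarrow> lin (\<lambda>v. f v - g v)"
  by (simp add: lin_iff scale_distribs)

lemma lin_sum_fun: "(\<And>i. i \<in> I \<Longrightarrow> lin (f i)) \<Longrightarrow> lin (\<lambda>v. \<Sum>i\<in>I. f i v)"
  by (simp add: lin_iff sum.distrib scale_sum)

lemma lookup_lin_ext:
  "lookup (lin_ext \<phi> v) j = (\<Sum>i\<in>keys v. lookup v i * lookup (\<phi> i) j)"
  by (simp add: lin_ext_def lookup_sum)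

lemma lookup_lin:
  assumes "lin f"
  shows "lookup (f v) j = (\<Sum>i\<in>keys v. lookup v i * lookup (f (single i 1)) j)"
  by (subst lin_ext_lin[OF assms]) (rule lookup_lin_ext)

lemma lookup_coord_proj: "lookup (coord_proj X v) i = (if i \<in> X then lookup v i else 0)"
  by (auto simp: coord_proj_def lookup_mapp when_def in_keys_iff)

lemma lin_coord_proj [simp]: "lin (coord_proj X)"
  by (auto simp: lin_iff lookup_coord_proj lookup_add intro!: poly_mapping_eqI)

lemma coord_proj_single: "coord_proj X (single i r) = (if i \<in> X then single i r else 0)"
  by (auto simp: lookup_coord_proj lookup_single when_def intro!: poly_mapping_eqI)

lemma coord_proj_id: "v \<in> coord_space X \<Longrightarrow> coord_proj X v = v"
  by (auto simp: coord_space_def lookup_coord_proj in_keys_iff intro!: poly_mapping_eqI)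

lemma coord_space_iff: "v \<in> coord_space X \<longleftrightarrow> (\<forall>i. i \<notin> X \<longrightarrow> lookup v i = 0)"
  by (auto simp: coord_space_def in_keys_iff)

lemma coord_space_closed:
  "0 \<in> coord_space X"
  "u \<in> coord_space X \<Longrightarrow> v \<in> coord_space X \<Longrightarrow> u + v \<in> coord_space X"
  "u \<in> coord_space X \<Longrightarrow> v \<in> coord_space X \<Longrightarrow> u - v \<in> coord_space X"
  "u \<in> coord_space X \<Longrightarrow> - u \<in> coord_space X"
  "u \<in> coord_space X \<Longrightarrow> r *\<^sub>k u \<in> coord_space X"
  by (auto simp: coord_space_iff lookup_add lookup_minus)

lemma coord_space_sum: "(\<And>i. i \<in> I \<Longrightarrow> f i \<in> coord_space X) \<Longrightarrow> sum f I \<in> coord_space X"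
  by (induction I rule: infinite_finite_induct) (auto simp: coord_space_closed)

lemma single_in_coord_space [simp]: "single i r \<in> coord_space X \<longleftrightarrow> i \<in> X \<or> r = 0"
  by (auto simp: coord_space_iff lookup_single when_def)

lemma lin_ext_in_coord_space:
  assumes "v \<in> coord_space X" "\<And>i. i \<in> X \<Longrightarrow> \<phi> i \<in> coord_space Y"
  shows "lin_ext \<phi> v \<in> coord_space Y"
  unfolding lin_ext_def using assms
  by (intro coord_space_sum coord_space_closed(5)) (auto simp: coord_space_def)

lemma lin_image_in_coord_space:
  assumes "lin f" "v \<in> coord_space X" "\<And>i. i \<in> X \<Longrightarrow> f (single i 1) \<in> coord_space Y"
  shows "f v \<in> coord_space Y"
  by (subst lin_ext_lin[OF assms(1)]) (rule lin_ext_in_coord_space[OF assms(2,3)])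

lemma tensor_single [simp]: "single i r \<otimes> single j s = single (i, j) (r * s)"
  by (rule poly_mapping_eqI) (auto simp: lookup_tensor lookup_single when_def split: if_splits)

lemma lin_tensor_left [simp]: "lin (\<lambda>v. v \<otimes> w)"
  by (auto simp: lin_iff lookup_tensor lookup_add algebra_simps intro!: poly_mapping_eqI)

lemma lin_tensor_right [simp]: "lin (\<lambda>w. v \<otimes> w)"
  by (auto simp: lin_iff lookup_tensor lookup_add algebra_simps intro!: poly_mapping_eqI)

lemma lin_tensor_map [simp]: "lin (f \<Otimes> g)"
  by (simp add: tensor_map_def)

lemma tensor_map_single [simp]: "(f \<Otimes> g) (single (i, j) 1) = f (single i 1) \<otimes> g (single j 1)"
  by (simp add: tensor_map_def)

lemma bilin_eqI:
  fixes f g :: "('i \<Rightarrow>\<^sub>0 'k::field) \<Rightarrow> ('j \<Rightarrow>\<^sub>0 'k) \<Rightarrow> ('l \<Rightarrow>\<^sub>0 'k)"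
  assumes "\<And>w. lin (\<lambda>v. f v w)" "\<And>w. lin (\<lambda>v. g v w)" "\<And>v. lin (f v)" "\<And>v. lin (g v)"
    and "\<And>i j. f (single i 1) (single j 1) = g (single i 1) (single j 1)"
  shows "f v w = g v w"
proof -
  have "f (single i 1) w = g (single i 1) w" for i
    by (rule lin_eqI[OF assms(3,4)]) (rule assms(5))
  then show ?thesis
    by (rule lin_eqI[OF assms(1,2)])
qed

lemma lin_mid_map [simp]: "lin (mid_map f)"
  unfolding mid_map_def by (rule lin_o[OF lin_o[OF lin_lin_ext lin_tensor_map] lin_lin_ext])

text \<open>The rebracketings in \<open>mid_map\<close> cancel on basis vectors, leaving the outer
  indices \<open>p\<close> and \<open>s\<close> around the output of \<open>f\<close>.\<close>

lemma mid_map_single: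
  assumes "lin f"
  shows "mid_map f (single ((p, v), (w, s)) 1) =
    lin_ext (\<lambda>(v', w'). single ((p, v'), (w', s)) 1) (f (single (v, w) 1))"
proof -
  let ?h = "lin_ext (\<lambda>(p, (v, w), s). single ((p, v), (w, s)) 1)"
  have "mid_map f (single ((p, v), (w, s)) 1) = ?h (single p 1 \<otimes> (f (single (v, w) 1) \<otimes> single s 1))"
    by (simp add: mid_map_def id_def)
  also have "\<dots> = lin_ext (\<lambda>(v', w'). single ((p, v'), (w', s)) 1) (f (single (v, w) 1))"
  proof (rule lin_eqI[where f = "\<lambda>u. ?h (single p 1 \<otimes> (u \<otimes> single s 1))"])
    show "lin (\<lambda>u. ?h (single p 1 \<otimes> (u \<otimes> single s 1)))"
      by (rule lin_comp[OF lin_lin_ext lin_comp[OF lin_tensor_right lin_tensor_left]])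
  qed auto
  finally show ?thesis .
qed

section \<open>Twisted multiplications of two polynomial rings\<close>

abbreviation xy :: "nat \<Rightarrow> nat \<Rightarrow> (nat \<times> nat \<Rightarrow>\<^sub>0 'k::field)"
  where "xy i j \<equiv> single (i, j) 1"

text \<open>Left multiplication by x^i together with right multiplication by y^l: the part of the
  product on K[x] \<otimes> K[y] that no twisting changes.\<close>

definition shift :: "nat \<Rightarrow> nat \<Rightarrow> (nat \<times> nat \<Rightarrow>\<^sub>0 'k::field) \<Rightarrow> (nat \<times> nat \<Rightarrow>\<^sub>0 'k)"
  where "shift i l = lin_ext (\<lambda>(v, w). xy (i + v) (w + l))"

lemma lin_shift [simp]: "lin (shift i l)"
  by (simp add: shift_def)

lemma shift_xy [simp]: "shift i l (xy v w) = xy (i + v) (w + l)"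
  by (simp add: shift_def)

lemma lookup_shift:
  "lookup (shift i l v) (p, q) = (if i \<le> p \<and> l \<le> q then lookup v (p - i, q - l) else 0)"
proof -
  have "lookup (shift i l v) (p, q) =
      (\<Sum>z\<in>keys v. lookup v z * (if i \<le> p \<and> l \<le> q \<and> z = (p - i, q - l) then 1 else 0))"
    unfolding shift_def lookup_lin_ext
    by (intro sum.cong refl) (auto simp: lookup_single when_def split: prod.splits)
  also have "\<dots> = (if i \<le> p \<and> l \<le> q then lookup v (p - i, q - l) else 0)"
    by (auto simp: if_distrib sum.delta in_keys_iff cong: if_cong)
  finally show ?thesis .
qed

lemma shift_shift [simp]: "shift i l (shift i' l' v) = shift (i + i') (l' + l) v"
  by (rule lin_eqI[where f = "\<lambda>v. shift i l (shift i' l' v)"]) (auto intro: lin_comp simp: add_ac)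

lemma shift_0 [simp]: "shift 0 0 v = v"
  by (rule lin_eqI) auto

abbreviation twisted_poly ::
  "((nat \<times> nat \<Rightarrow>\<^sub>0 'k::field) \<Rightarrow> (nat \<times> nat \<Rightarrow>\<^sub>0 'k)) \<Rightarrow> (nat \<times> nat, 'k) galg"
  where "twisted_poly \<sigma> \<equiv> twisted_tensor_product polynomial_algebra polynomial_algebra \<sigma>"

text \<open>The map is arbitrary here because the uniqueness argument also multiplies with a
  truncated candidate extension, which is not known to be a twisting map.\<close>

definition tmult ::
  "((nat \<times> nat \<Rightarrow>\<^sub>0 'k::field) \<Rightarrow> (nat \<times> nat \<Rightarrow>\<^sub>0 'k)) \<Rightarrow>
   (nat \<times> nat \<Rightarrow>\<^sub>0 'k) \<Rightarrow> (nat \<times> nat \<Rightarrow>\<^sub>0 'k) \<Rightarrow> (nat \<times> nat \<Rightarrow>\<^sub>0 'k)"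
  where "tmult \<sigma> u v = gmult (twisted_poly \<sigma>) (u \<otimes> v)"

lemma gmult_polynomial_single: "gmult polynomial_algebra (single (i, j) 1) = single (i + j) 1"
  using gmult_polynomial_algebra[of "single i 1" "single j 1"] by (simp add: mult_single)

lemma lin_gmult_polynomial [simp]: "lin (gmult polynomial_algebra)"
  by (simp add: polynomial_algebra_def)

lemma gmult_twisted_poly:
  "gmult (twisted_poly \<sigma>) =
    (gmult polynomial_algebra \<Otimes> gmult polynomial_algebra) \<circ> mid_map \<sigma>"
  by (simp add: twisted_tensor_product_def)

lemma lin_gmult_twisted_poly [simp]: "lin (gmult (twisted_poly \<sigma>))"
  unfolding gmult_twisted_poly by (rule lin_o) auto

lemma lin_tmult [simp]: "lin (\<lambda>u. tmult \<sigma> u v)" "lin (tmult \<sigma> u)"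
  unfolding tmult_def by (auto intro: lin_comp)

context
  fixes \<sigma> :: "(nat \<times> nat \<Rightarrow>\<^sub>0 'k::field) \<Rightarrow> (nat \<times> nat \<Rightarrow>\<^sub>0 'k)"
  assumes \<sigma>: "lin \<sigma>"
begin

lemma tmult_xy: "tmult \<sigma> (xy i j) (xy k l) = shift i l (\<sigma> (xy j k))"
proof -
  let ?m = "gmult polynomial_algebra :: (nat \<times> nat \<Rightarrow>\<^sub>0 'k) \<Rightarrow> _"
  have "(?m \<Otimes> ?m) (lin_ext (\<lambda>(v, w). single ((i, v), (w, l)) 1) u) = shift i l u" for u
    by (rule lin_eqI[where f = "\<lambda>u. (?m \<Otimes> ?m) (lin_ext (\<lambda>(v, w). single ((i, v), (w, l)) 1) u)"])
      (auto intro: lin_comp simp: gmult_polynomial_single)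
  then show ?thesis
    by (simp add: tmult_def gmult_twisted_poly mid_map_single[OF \<sigma>])
qed

lemma tmult_shift_left: "tmult \<sigma> (shift i 0 u) v = shift i 0 (tmult \<sigma> u v)"
proof (rule bilin_eqI[where f = "\<lambda>u v. tmult \<sigma> (shift i 0 u) v"
      and g = "\<lambda>u v. shift i 0 (tmult \<sigma> u v)"])
  show "lin (\<lambda>u. tmult \<sigma> (shift i 0 u) v)" for v
    by (rule lin_comp[OF lin_tmult(1) lin_shift])
  show "lin (\<lambda>u. shift i 0 (tmult \<sigma> u v))" for v
    by (rule lin_comp[OF lin_shift lin_tmult(1)])
  show "lin (\<lambda>v. shift i 0 (tmult \<sigma> u v))" for u
    by (rule lin_comp[OF lin_shift lin_tmult(2)])
  show "tmult \<sigma> (shift i 0 (single p 1)) (single q 1) = shift i 0 (tmult \<sigma> (single p 1) (single q 1))"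
    for p q by (cases p; cases q) (simp add: tmult_xy)
qed simp

lemma tmult_shift_right: "tmult \<sigma> u (shift 0 l v) = shift 0 l (tmult \<sigma> u v)"
proof (rule bilin_eqI[where f = "\<lambda>u v. tmult \<sigma> u (shift 0 l v)"
      and g = "\<lambda>u v. shift 0 l (tmult \<sigma> u v)"])
  show "lin (\<lambda>v. tmult \<sigma> u (shift 0 l v))" for u
    by (rule lin_comp[OF lin_tmult(2) lin_shift])
  show "lin (\<lambda>u. shift 0 l (tmult \<sigma> u v))" for v
    by (rule lin_comp[OF lin_shift lin_tmult(1)])
  show "lin (\<lambda>v. shift 0 l (tmult \<sigma> u v))" for u
    by (rule lin_comp[OF lin_shift lin_tmult(2)])
  show "tmult \<sigma> (single p 1) (shift 0 l (single q 1)) = shift 0 l (tmult \<sigma> (single p 1) (single q 1))"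
    for p q by (cases p; cases q) (simp add: tmult_xy add_ac)
qed simp

text \<open>In y^j y^l x^k x^p the inner pair is exchanged first; each resulting term x^i y^m leaves
  y^j x^i and y^m x^p to be exchanged and then multiplied.\<close>

lemma twisting_rhs_single:
  "((gmult polynomial_algebra \<Otimes> gmult polynomial_algebra) \<circ> mid_map \<sigma> \<circ> (\<sigma> \<Otimes> \<sigma>) \<circ> mid_map \<sigma>)
     (single ((j, l), (k, p)) 1) =
   lin_ext (\<lambda>(i, m). tmult \<sigma> (\<sigma> (xy j i)) (\<sigma> (xy m p))) (\<sigma> (xy l k))"
proof -
  let ?h = "gmult (twisted_poly \<sigma>)"
  have "?h ((\<sigma> \<Otimes> \<sigma>) (lin_ext (\<lambda>(i, m). single ((j, i), (m, p)) 1) u)) =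
      lin_ext (\<lambda>(i, m). tmult \<sigma> (\<sigma> (xy j i)) (\<sigma> (xy m p))) u" for u
  proof (rule lin_eqI[where f = "\<lambda>u. ?h ((\<sigma> \<Otimes> \<sigma>) (lin_ext (\<lambda>(i, m). single ((j, i), (m, p)) 1) u))"])
    show "lin (\<lambda>u. ?h ((\<sigma> \<Otimes> \<sigma>) (lin_ext (\<lambda>(i, m). single ((j, i), (m, p)) 1) u)))"
      by (rule lin_comp[OF lin_gmult_twisted_poly lin_comp[OF lin_tensor_map lin_lin_ext]])
  qed (auto simp: tmult_def)
  then show ?thesis
    by (simp add: mid_map_single[OF \<sigma>] gmult_twisted_poly)
qed

end

section \<open>Associativity of the twisted product\<close>

locale poly_twisting =
  fixes \<tau> :: "(nat \<times> nat \<Rightarrow>\<^sub>0 'k::field) \<Rightarrow> (nat \<times> nat \<Rightarrow>\<^sub>0 'k)"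
  assumes twisting: "graded_twisting_map polynomial_algebra polynomial_algebra \<tau>"
begin

abbreviation mult (infixl \<open>\<odot>\<close> 70)
  where "u \<odot> v \<equiv> tmult \<tau> u v"

lemma lin_\<tau>: "lin \<tau>"
  using twisting by (simp add: graded_twisting_map_def graded_linear_map_def)

lemma \<tau>_0_left: "\<tau> (xy 0 k) = xy k 0"
proof -
  have "\<tau> (1 \<otimes> single k 1) = single k 1 \<otimes> 1"
    using twisting by (simp add: graded_twisting_map_def polynomial_algebra_def)
  then show ?thesis
    by (simp add: single_one[symmetric] del: single_one)
qed

lemma \<tau>_0_right: "\<tau> (xy j 0) = xy 0 j"
proof -
  have "\<tau> (single j 1 \<otimes> 1) = 1 \<otimes> single j 1"
    using twisting by (simp add: graded_twisting_map_def polynomial_algebra_def)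
  then show ?thesis
    by (simp add: single_one[symmetric] del: single_one)
qed

lemma \<tau>_degree: "lookup (\<tau> (xy j k)) (p, q) \<noteq> 0 \<Longrightarrow> p + q = j + k"
proof -
  assume nz: "lookup (\<tau> (xy j k)) (p, q) \<noteq> 0"
  have "\<tau> ` homog (tensor_deg id id) (j + k) \<subseteq> homog (tensor_deg id id) (j + k)"
    using twisting
    by (simp add: graded_twisting_map_def graded_linear_map_def polynomial_algebra_def)
  then have "\<tau> (xy j k) \<in> homog (tensor_deg id id) (j + k)"
    by (auto simp: homog_def tensor_deg_def)
  then show ?thesis
    using nz by (auto simp: homog_def coord_space_iff tensor_deg_def)
qed

lemma \<tau>_mult:
  "\<tau> (xy (j + l) (k + p)) = lin_ext (\<lambda>(i, m). \<tau> (xy j i) \<odot> \<tau> (xy m p)) (\<tau> (xy l k))"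
proof -
  let ?m = "gmult polynomial_algebra :: (nat \<times> nat \<Rightarrow>\<^sub>0 'k) \<Rightarrow> _"
  have "(\<tau> \<circ> (?m \<Otimes> ?m)) (single ((j, l), (k, p)) 1) =
      ((?m \<Otimes> ?m) \<circ> mid_map \<tau> \<circ> (\<tau> \<Otimes> \<tau>) \<circ> mid_map \<tau>) (single ((j, l), (k, p)) 1)"
    using twisting by (simp add: graded_twisting_map_def)
  then show ?thesis
    unfolding twisting_rhs_single[OF lin_\<tau>] by (simp add: gmult_polynomial_single)
qed

text \<open>With no inner power of x the inner exchange is trivial. This and the mirror case
  \<open>\<tau>_mult_x\<close> are the instances of the twisting axiom from which associativity is
  derived.\<close>

lemma y_mult_\<tau>: "xy 0 j \<odot> \<tau> (xy l p) = \<tau> (xy (j + l) p)"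
  using \<tau>_mult[of j l 0 p] by (simp add: \<tau>_0_right)

lemma \<tau>_mult_x: "\<tau> (xy j k) \<odot> xy p 0 = \<tau> (xy j (k + p))"
  using \<tau>_mult[of j 0 k p] by (simp add: \<tau>_0_left)

lemma mult_xy: "xy i j \<odot> xy k l = shift i l (\<tau> (xy j k))"
  by (rule tmult_xy[OF lin_\<tau>])

lemma mult_add: "(u + v) \<odot> w = u \<odot> w + v \<odot> w" "u \<odot> (v + w) = u \<odot> v + u \<odot> w"
  and mult_diff: "(u - v) \<odot> w = u \<odot> w - v \<odot> w" "u \<odot> (v - w) = u \<odot> v - u \<odot> w"
  and mult_scale: "(r *\<^sub>k u) \<odot> w = r *\<^sub>k (u \<odot> w)" "u \<odot> (r *\<^sub>k w) = r *\<^sub>k (u \<odot> w)"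
  and mult_minus: "(- u) \<odot> w = - (u \<odot> w)" "u \<odot> (- w) = - (u \<odot> w)"
  and mult_zero: "0 \<odot> w = 0" "u \<odot> 0 = 0"
  by (rule lin_add[OF lin_tmult(1)] lin_add[OF lin_tmult(2)] lin_diff[OF lin_tmult(1)]
      lin_diff[OF lin_tmult(2)] lin_scale[OF lin_tmult(1)] lin_scale[OF lin_tmult(2)]
      lin_minus[OF lin_tmult(1)] lin_minus[OF lin_tmult(2)]
      lin_zero[OF lin_tmult(1)] lin_zero[OF lin_tmult(2)])+

lemmas mult_simps = mult_add mult_diff mult_scale mult_minus mult_zero

text \<open>Associativity for \<open>u\<close>, y^l and x^p: a leading x^i can be pulled out of
  \<open>u\<close>, and \<open>y_mult_\<tau>\<close> handles the remaining power of y.\<close>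

lemma shift_mult_x: "shift 0 l u \<odot> xy p 0 = u \<odot> \<tau> (xy l p)"
proof (rule lin_eqI[where f = "\<lambda>u. shift 0 l u \<odot> xy p 0"])
  show "lin (\<lambda>u. shift 0 l u \<odot> xy p 0)"
    by (rule lin_comp[OF lin_tmult(1) lin_shift])
  fix z :: "nat \<times> nat"
  obtain i m where z: "z = (i, m)" by (cases z)
  have "shift 0 l (xy i m) \<odot> xy p 0 = shift i 0 (xy 0 m \<odot> \<tau> (xy l p))"
    by (simp add: mult_xy y_mult_\<tau>)
  also have "\<dots> = xy i m \<odot> \<tau> (xy l p)"
    by (simp flip: tmult_shift_left[OF lin_\<tau>])
  finally show "shift 0 l (single z 1) \<odot> xy p 0 = single z 1 \<odot> \<tau> (xy l p)"
    by (simp add: z)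
qed simp

lemma y_mult_shift: "xy 0 j \<odot> shift k 0 v = \<tau> (xy j k) \<odot> v"
proof (rule lin_eqI[where f = "\<lambda>v. xy 0 j \<odot> shift k 0 v"])
  show "lin (\<lambda>v. xy 0 j \<odot> shift k 0 v)"
    by (rule lin_comp[OF lin_tmult(2) lin_shift])
  fix z :: "nat \<times> nat"
  obtain i m where z: "z = (i, m)" by (cases z)
  have "xy 0 j \<odot> shift k 0 (xy i m) = shift 0 m (\<tau> (xy j k) \<odot> xy i 0)"
    by (simp add: mult_xy \<tau>_mult_x)
  also have "\<dots> = \<tau> (xy j k) \<odot> xy i m"
    by (simp flip: tmult_shift_right[OF lin_\<tau>])
  finally show "xy 0 j \<odot> shift k 0 (single z 1) = \<tau> (xy j k) \<odot> single z 1"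
    by (simp add: z)
qed simp

text \<open>Both bracketings equal the product of \<tau>(y^j \<otimes> x^k) and \<tau>(y^l \<otimes>
  x^p) between x^i and y^q: the middle factor x^k y^l is split, y^l being absorbed on the right and
  x^k on the left.\<close>

lemma mult_assoc_xy: "xy i j \<odot> xy k l \<odot> xy p q = xy i j \<odot> (xy k l \<odot> xy p q)"
proof -
  have "xy i j \<odot> xy k l \<odot> xy p q = shift i q (shift 0 l (\<tau> (xy j k)) \<odot> xy p 0)"
    using tmult_shift_left[OF lin_\<tau>, of i "shift 0 l (\<tau> (xy j k))" "xy p q"]
      tmult_shift_right[OF lin_\<tau>, of "shift 0 l (\<tau> (xy j k))" q "xy p 0"]
    by (simp add: mult_xy)
  also have "\<dots> = shift i q (xy 0 j \<odot> shift k 0 (\<tau> (xy l p)))"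
    by (simp add: shift_mult_x y_mult_shift)
  also have "\<dots> = xy i j \<odot> (xy k l \<odot> xy p q)"
    using tmult_shift_left[OF lin_\<tau>, of i "xy 0 j" "shift k q (\<tau> (xy l p))"]
      tmult_shift_right[OF lin_\<tau>, of "xy 0 j" q "shift k 0 (\<tau> (xy l p))"]
    by (simp add: mult_xy)
  finally show ?thesis .
qed

lemma mult_assoc: "u \<odot> v \<odot> w = u \<odot> (v \<odot> w)"
proof -
  have 1: "single p 1 \<odot> single q 1 \<odot> w = single p 1 \<odot> (single q 1 \<odot> w)" for p q w
    by (rule lin_eqI[where g = "\<lambda>w. single p 1 \<odot> (single q 1 \<odot> w)"])
      (cases p; cases q; auto intro: lin_comp[OF lin_tmult(2) lin_tmult(2)] simp: mult_assoc_xy)+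
  have 2: "single p 1 \<odot> v \<odot> w = single p 1 \<odot> (v \<odot> w)" for p v w
    by (rule lin_eqI[where f = "\<lambda>v. single p 1 \<odot> v \<odot> w" and g = "\<lambda>v. single p 1 \<odot> (v \<odot> w)"])
      (auto intro: lin_comp[OF lin_tmult(1) lin_tmult(2)] lin_comp[OF lin_tmult(2) lin_tmult(1)] simp: 1)
  show ?thesis
    by (rule lin_eqI[where f = "\<lambda>u. u \<odot> v \<odot> w"])
      (auto intro: lin_comp[OF lin_tmult(1) lin_tmult(1)] simp: 2)
qed

lemma one_mult [simp]: "xy 0 0 \<odot> v = v"
  by (rule lin_eqI) (auto simp: mult_xy \<tau>_0_left)

lemma mult_one [simp]: "v \<odot> xy 0 0 = v"
  by (rule lin_eqI[where f = "\<lambda>v. v \<odot> xy 0 0"]) (auto simp: mult_xy \<tau>_0_right)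

lemma mult_y [simp]: "v \<odot> xy 0 l = shift 0 l v"
  using tmult_shift_right[OF lin_\<tau>, of v l "xy 0 0"] by simp

lemma x_mult [simp]: "xy i 0 \<odot> v = shift i 0 v"
  using tmult_shift_left[OF lin_\<tau>, of i "xy 0 0" v] by simp

end

section \<open>Words in the generators of an algebra\<close>

lemma subspace_iff:
  "module.subspace scale S \<longleftrightarrow>
    0 \<in> S \<and> (\<forall>u\<in>S. \<forall>v\<in>S. u + v \<in> S) \<and> (\<forall>r. \<forall>v\<in>S. r *\<^sub>k v \<in> S)"
  using module.subspace_def[of scale S] vector_space_scale by (simp add: module_iff_vector_space)

lemma lin_word_mult [simp]: "lin (\<lambda>v. word_mult v w)" "lin (word_mult v)"
  unfolding word_mult_def by (rule lin_comp[OF lin_lin_ext lin_tensor_left])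
    (rule lin_comp[OF lin_lin_ext lin_tensor_right])

lemma word_mult_single [simp]: "word_mult (single p 1) (single q 1) = single (p @ q) 1"
  by (simp add: word_mult_def)

lemma word_mult_simps:
  "word_mult (u + v) w = word_mult u w + word_mult v w"
  "word_mult u (v + w) = word_mult u v + word_mult u w"
  "word_mult (u - v) w = word_mult u w - word_mult v w"
  "word_mult u (v - w) = word_mult u v - word_mult u w"
  "word_mult (r *\<^sub>k u) w = r *\<^sub>k word_mult u w"
  "word_mult u (r *\<^sub>k w) = r *\<^sub>k word_mult u w"
  "word_mult 0 w = 0" "word_mult u 0 = 0"
  by (rule lin_add[OF lin_word_mult(1)] lin_add[OF lin_word_mult(2)]
      lin_diff[OF lin_word_mult(1)] lin_diff[OF lin_word_mult(2)]
      lin_scale[OF lin_word_mult(1)] lin_scale[OF lin_word_mult(2)]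
      lin_zero[OF lin_word_mult(1)] lin_zero[OF lin_word_mult(2)])+

lemma word_mult_assoc: "word_mult (word_mult u v) w = word_mult u (word_mult v w)"
proof -
  have 1: "word_mult (word_mult (single p 1) v) w = word_mult (single p 1) (word_mult v w)" for p
  proof (rule bilin_eqI[where f = "\<lambda>v. word_mult (word_mult (single p 1) v)"
        and g = "\<lambda>v w. word_mult (single p 1) (word_mult v w)"])
    show "lin (\<lambda>v. word_mult (word_mult (single p 1) v) w)" for w
      by (rule lin_comp[OF lin_word_mult(1) lin_word_mult(2)])
    show "lin (\<lambda>v. word_mult (single p 1) (word_mult v w))" for w
      by (rule lin_comp[OF lin_word_mult(2) lin_word_mult(1)])
    show "lin (\<lambda>w. word_mult (single p 1) (word_mult v w))" for v
      by (rule lin_comp[OF lin_word_mult(2) lin_word_mult(2)])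
  qed simp_all
  show ?thesis
  proof (rule lin_eqI[where f = "\<lambda>u. word_mult (word_mult u v) w"])
    show "lin (\<lambda>u. word_mult (word_mult u v) w)"
      by (rule lin_comp[OF lin_word_mult(1) lin_word_mult(1)])
  qed (simp_all add: 1)
qed

lemma word_mult_in_coord_space:
  assumes "u \<in> coord_space X" "v \<in> coord_space Y" "\<And>p q. p \<in> X \<Longrightarrow> q \<in> Y \<Longrightarrow> p @ q \<in> Z"
  shows "word_mult u v \<in> coord_space Z"
proof -
  have "u \<otimes> v \<in> coord_space (X \<times> Y)"
    using assms(1,2) by (auto simp: coord_space_iff lookup_tensor)
  then show ?thesis
    unfolding word_mult_def by (rule lin_ext_in_coord_space) (use assms(3) in auto)
qed

lemma lin_word_eval [simp]: "lin (word_eval D)"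
  by (simp add: word_eval_def)

lemma word_eval_single:
  "word_eval D (single w 1) = foldr (\<lambda>i v. gmult D (single i 1 \<otimes> v)) w (gone D)"
  by (simp add: word_eval_def)

text \<open>On words this is an induction on the left word by associativity; bilinearity does the
  rest.\<close>

lemma word_eval_mult:
  assumes D: "graded_algebra D"
  shows "word_eval D (word_mult v w) = gmult D (word_eval D v \<otimes> word_eval D w)"
proof (rule bilin_eqI[where f = "\<lambda>v w. word_eval D (word_mult v w)"
      and g = "\<lambda>v w. gmult D (word_eval D v \<otimes> word_eval D w)"])
  have lin: "lin (gmult D)"
    using D by (simp add: graded_algebra_def graded_linear_map_def)
  show "lin (\<lambda>v. word_eval D (word_mult v w))" for w
    by (rule lin_comp[OF lin_word_eval lin_word_mult(1)])
  show "lin (\<lambda>w. word_eval D (word_mult v w))" for v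
    by (rule lin_comp[OF lin_word_eval lin_word_mult(2)])
  show "lin (\<lambda>v. gmult D (word_eval D v \<otimes> word_eval D w))" for w
    by (rule lin_comp[OF lin lin_comp[OF lin_tensor_left lin_word_eval]])
  show "lin (\<lambda>w. gmult D (word_eval D v \<otimes> word_eval D w))" for v
    by (rule lin_comp[OF lin lin_comp[OF lin_tensor_right lin_word_eval]])
  show "word_eval D (word_mult (single p 1) (single q 1)) =
      gmult D (word_eval D (single p 1) \<otimes> word_eval D (single q 1))" for p q
    using D by (induction p) (simp_all add: word_eval_single graded_algebra_def)
qed

section \<open>Free modules\<close>

lemma tensor_coord_space:
  "v \<in> coord_space X \<Longrightarrow> v \<otimes> single w r \<in> coord_space (X \<times> {w})"
  by (auto simp: coord_space_iff lookup_tensor lookup_single when_def)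

definition component :: "'s \<Rightarrow> ('i \<times> 's \<Rightarrow>\<^sub>0 'k::field) \<Rightarrow> ('i \<Rightarrow>\<^sub>0 'k)"
  where "component w = lin_ext (\<lambda>(i, w'). if w' = w then single i 1 else 0)"

lemma sum_components:
  fixes p :: "'i \<times> 's \<Rightarrow>\<^sub>0 'k::field"
  assumes "p \<in> coord_space (UNIV \<times> S)" "finite S"
  shows "p = (\<Sum>w\<in>S. component w p \<otimes> single w 1)"
proof (rule lin_eqI[where g = "\<lambda>p. \<Sum>w\<in>S. component w p \<otimes> single w 1"])
  show "lin (\<lambda>p::'i \<times> 's \<Rightarrow>\<^sub>0 'k. \<Sum>w\<in>S. component w p \<otimes> single w 1)"
    unfolding component_def by (rule lin_sum_fun) (rule lin_comp[OF lin_tensor_left lin_lin_ext])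
  fix z assume "z \<in> keys p"
  then obtain i w where z: "z = (i, w)" "w \<in> S"
    using assms by (auto simp: coord_space_def)
  have "(\<Sum>w'\<in>S. component w' (single z 1) \<otimes> single w' (1::'k)) = (\<Sum>w'\<in>S. if w' = w then single z 1 else 0)"
    by (intro sum.cong refl) (auto simp: z component_def lin_zero[OF lin_tensor_left])
  also have "\<dots> = single z 1"
    using z assms by simp
  finally show "single z 1 = (\<Sum>w'\<in>S. component w' (single z 1) \<otimes> single w' (1::'k))" ..
qed simp

text \<open>For a graded algebra \<open>D\<close>, this is the homomorphism of free left modules
  that sends each generator \<open>w\<close> to \<open>g w\<close>.\<close>

definition free_ext ::
  "('i, 'k::field) galg \<Rightarrow> ('s \<Rightarrow> ('i \<times> 't \<Rightarrow>\<^sub>0 'k)) \<Rightarrow> ('i \<times> 's \<Rightarrow>\<^sub>0 'k) \<Rightarrow> ('i \<times> 't \<Rightarrow>\<^sub>0 'k)"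
  where "free_ext D g = lin_ext (\<lambda>(i, w). free_act D (single i 1) (g w))"

lemma lin_free_ext [simp]: "lin (free_ext D g)"
  by (simp add: free_ext_def)

context
  fixes D :: "('i, 'k::field) galg"
  assumes D: "graded_algebra D"
begin

lemma lin_gmult: "lin (gmult D)"
  using D by (simp add: graded_algebra_def graded_linear_map_def)

lemma lin_free_act: "lin (\<lambda>v. free_act D v p)" "lin (free_act D v)"
  unfolding free_act_def
  by (rule lin_comp[OF lin_tensor_map lin_comp[OF lin_lin_ext lin_tensor_left]])
    (rule lin_comp[OF lin_tensor_map lin_comp[OF lin_lin_ext lin_tensor_right]])

lemma free_act_tensor: "free_act D c (v \<otimes> w) = gmult D (c \<otimes> v) \<otimes> w"
proof -
  have 1: "free_act D (single i 1) (v \<otimes> w) = gmult D (single i 1 \<otimes> v) \<otimes> w" for i v w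
  proof (rule bilin_eqI[where f = "\<lambda>v w. free_act D (single i 1) (v \<otimes> w)"
        and g = "\<lambda>v w. gmult D (single i 1 \<otimes> v) \<otimes> w"])
    show "lin (\<lambda>v. free_act D (single i 1) (v \<otimes> w))" for w :: "'b \<Rightarrow>\<^sub>0 'k"
      by (rule lin_comp[OF lin_free_act(2) lin_tensor_left])
    show "lin (\<lambda>w. free_act D (single i 1) (v \<otimes> w))" for v
      by (rule lin_comp[OF lin_free_act(2) lin_tensor_right])
    show "lin (\<lambda>v. gmult D (single i 1 \<otimes> v) \<otimes> w)" for w :: "'b \<Rightarrow>\<^sub>0 'k"
      by (rule lin_comp[OF lin_tensor_left lin_comp[OF lin_gmult lin_tensor_right]])
  qed (simp_all add: free_act_def)
  show ?thesis
  proof (rule lin_eqI[where f = "\<lambda>c. free_act D c (v \<otimes> w)" and g = "\<lambda>c. gmult D (c \<otimes> v) \<otimes> w"])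
    show "lin (\<lambda>c. gmult D (c \<otimes> v) \<otimes> w)"
      by (rule lin_comp[OF lin_tensor_left lin_comp[OF lin_gmult lin_tensor_left]])
  qed (simp_all add: 1 lin_free_act)
qed

lemma free_act_assoc: "free_act D c (free_act D d p) = free_act D (gmult D (c \<otimes> d)) p"
proof (rule lin_eqI[where f = "\<lambda>p. free_act D c (free_act D d p)"])
  fix z :: "'i \<times> 's"
  obtain i w where z: "z = (i, w)" by (cases z)
  have "single z (1::'k) = single i 1 \<otimes> single w 1"
    by (simp add: z)
  then show "free_act D c (free_act D d (single z 1)) = free_act D (gmult D (c \<otimes> d)) (single z 1)"
    using D by (simp only: free_act_tensor) (simp add: graded_algebra_def)
qed (auto intro: lin_comp lin_free_act)

lemma free_ext_tensor: "free_ext D g (v \<otimes> single w 1) = free_act D v (g w)"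
  unfolding free_ext_def
  by (rule lin_eqI[where f = "\<lambda>v. lin_ext _ (v \<otimes> single w 1)"])
    (auto intro: lin_comp lin_free_act)

text \<open>Every basis vector is an algebra element times a generator, so this comes down to
  associativity of the action.\<close>

lemma free_ext_act:
  fixes g :: "'s \<Rightarrow> ('i \<times> 't \<Rightarrow>\<^sub>0 'k)"
  shows "free_ext D g (free_act D c p) = free_act D c (free_ext D g p)"
proof (rule lin_eqI[where f = "\<lambda>p. free_ext D g (free_act D c p)"])
  fix z :: "'i \<times> 's"
  obtain i w where z: "z = (i, w)" by (cases z)
  have "single z (1::'k) = single i 1 \<otimes> single w 1"
    by (simp add: z)
  then show "free_ext D g (free_act D c (single z 1)) = free_act D c (free_ext D g (single z 1))"
    by (simp only: free_act_tensor free_ext_tensor free_act_assoc)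
qed (auto intro: lin_comp lin_free_act)

end

section \<open>The relation in degree two\<close>

locale poly_twisting_relation = poly_twisting \<tau>
  for \<tau> :: "(nat \<times> nat \<Rightarrow>\<^sub>0 'k::field) \<Rightarrow> (nat \<times> nat \<Rightarrow>\<^sub>0 'k)" +
  fixes a b c :: 'k
  assumes \<tau>_yx: "\<tau> (xy 1 1) = a *\<^sub>k xy 2 0 + b *\<^sub>k xy 1 1 + c *\<^sub>k xy 0 2"
    and ac: "1 - a * c \<noteq> 0"
begin

section \<open>The coefficient of y^(j+1) in y^j x\<close>

definition t :: "nat \<Rightarrow> 'k"
  where "t j = lookup (\<tau> (xy j 1)) (0, Suc j)"

text \<open>Right multiplication by x never lowers the x-exponent of a term, so only terms of
  \<open>v\<close> with x-exponent at most \<open>i\<close> contribute. By degree, one with exponent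
  i' < i must be x^i' y^(i+j-i'), which the assumption excludes.\<close>

lemma lookup_mult_x:
  assumes "\<And>i'. i' < i \<Longrightarrow> lookup v (i', i + j - i') = 0"
  shows "lookup (v \<odot> xy 1 0) (i, Suc j) = lookup v (i, j) * t j"
proof -
  have "lookup v z * lookup (single z 1 \<odot> xy 1 0) (i, Suc j) =
      (if z = (i, j) then lookup v (i, j) * t j else 0)" for z
  proof (cases z)
    case (Pair p q)
    show ?thesis
    proof (cases "p \<le> i \<and> lookup (\<tau> (xy q 1)) (i - p, Suc j) \<noteq> 0")
      case True
      then have "p + q = i + j"
        using \<tau>_degree[of q 1 "i - p" "Suc j"] by auto
      show ?thesis
      proof (cases "p = i")
        case True
        with \<open>p + q = i + j\<close> show ?thesis
          by (simp add: Pair mult_xy lookup_shift t_def)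
      next
        case False
        then have "lookup v (p, i + j - p) = 0"
          using True assms[of p] by simp
        moreover have "i + j - p = q"
          using \<open>p + q = i + j\<close> by linarith
        ultimately show ?thesis
          using False by (simp add: Pair)
      qed
    qed (auto simp: Pair mult_xy lookup_shift t_def)
  qed
  then show ?thesis
    by (subst lookup_lin[OF lin_tmult(1)]) (simp add: sum.delta in_keys_iff)
qed

text \<open>The relation for y x, multiplied on the left by y^j.\<close>

lemma y_mult_\<tau>_yx:
  "\<tau> (xy (Suc j) 1) = a *\<^sub>k \<tau> (xy j 2) + b *\<^sub>k shift 0 1 (\<tau> (xy j 1)) + c *\<^sub>k xy 0 (j + 2)"
proof -
  have "\<tau> (xy (Suc j) 1) = xy 0 j \<odot> \<tau> (xy 1 1)"
    using y_mult_\<tau>[of j 1 1] by simp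
  also have "\<dots> = a *\<^sub>k \<tau> (xy j 2) + b *\<^sub>k shift 0 1 (\<tau> (xy j 1)) + c *\<^sub>k xy 0 (j + 2)"
    unfolding \<tau>_yx mult_simps mult_xy by (simp add: \<tau>_0_right add.commute del: scale_simps)
  finally show ?thesis .
qed

lemma t_0 [simp]: "t 0 = 0"
  by (simp add: t_def \<tau>_0_left lookup_single)

lemma t_Suc: "t (Suc j) * (1 - a * t j) = c + b * t j"
proof -
  have "\<tau> (xy j 2) = \<tau> (xy j 1) \<odot> xy 1 0"
    using \<tau>_mult_x[of j 1 1] by (simp add: numeral_2_eq_2)
  \<comment> \<open>For x-exponent 0 the assumption of \<open>lookup_mult_x\<close> is
    vacuous.\<close>
  then have "lookup (\<tau> (xy j 2)) (0, Suc (Suc j)) = t j * t (Suc j)"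
    by (simp add: lookup_mult_x t_def del: One_nat_def)
  moreover have "t (Suc j) = lookup (\<tau> (xy (Suc j) 1)) (0, Suc (Suc j))"
    by (simp add: t_def)
  ultimately have "t (Suc j) = a * (t j * t (Suc j)) + b * t j + c"
    unfolding y_mult_\<tau>_yx by (simp add: lookup_add lookup_shift lookup_single t_def)
  then show ?thesis
    by (simp add: algebra_simps)
qed

text \<open>The map \<open>t \<mapsto> (c + b t) / (1 - a t)\<close> reaches its pole only if it is constant, with value \<open>c\<close>.\<close>

lemma at_neq_1: "1 - a * t j \<noteq> 0"
proof
  assume pole: "1 - a * t j = 0"
  then have "c + b * t j = 0"
    using t_Suc[of j] by simp
  then have "a * c + b * (a * t j) = 0"
    by (metis distrib_left mult.left_commute mult_zero_right)
  then have b: "b = - (a * c)"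
    using pole by (simp add: eq_neg_iff_add_eq_0 add.commute)
  \<comment> \<open>With b = - a c the recursion reads t_(i+1) (1 - a t_i) = c (1 - a t_i), so a
    nonzero factor forces the next value to be \<open>c\<close>; at the values 0 and
    \<open>c\<close> this factor is 1 and 1 - a c.\<close>
  have "t i = 0 \<or> t i = c" for i
  proof (induction i)
    case (Suc i)
    have "(t (Suc i) - c) * (1 - a * t i) = 0"
      using t_Suc[of i] by (simp add: b algebra_simps)
    moreover have "1 - a * t i \<noteq> 0"
      using Suc ac by auto
    ultimately show ?case
      by simp
  qed simp
  then show False
    using pole ac by (metis diff_zero mult_zero_right one_neq_zero)
qed

section \<open>Right multiplication by u and the syzygies of x and y\<close>

definition u :: "nat \<times> nat \<Rightarrow>\<^sub>0 'k"
  where "u = xy 0 1 - a *\<^sub>k xy 1 0"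

definition s :: "nat \<times> nat \<Rightarrow>\<^sub>0 'k"
  where "s = b *\<^sub>k xy 1 0 + c *\<^sub>k xy 0 1"

lemma u_mult_x: "u \<odot> xy 1 0 = s \<odot> xy 0 1"
proof -
  have yx: "xy 0 1 \<odot> xy 1 0 = \<tau> (xy 1 1)"
    by (simp add: mult_xy)
  show ?thesis
    unfolding u_def s_def mult_simps yx \<tau>_yx by (simp add: numeral_2_eq_2 del: scale_simps)
qed

lemma mult_u: "v \<odot> u = shift 0 1 v - a *\<^sub>k (v \<odot> xy 1 0)"
  by (simp only: u_def mult_simps mult_y)

text \<open>Let x^i be the lowest power of x in \<open>v\<close>. On the terms with that power,
  right multiplication by \<open>u\<close> raises the y-exponent by one and scales by the nonzero 1
  - a t_j.\<close>

lemma mult_u_eq_0: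
  assumes "v \<odot> u = 0"
  shows "v = 0"
proof (rule ccontr)
  assume "v \<noteq> 0"
  define i where "i = (LEAST i. \<exists>j. lookup v (i, j) \<noteq> 0)"
  have "\<exists>i j. lookup v (i, j) \<noteq> 0"
    using \<open>v \<noteq> 0\<close> by (metis poly_mapping_eqI lookup_zero surj_pair)
  then have "\<exists>j. lookup v (i, j) \<noteq> 0"
    unfolding i_def by (rule LeastI_ex)
  then obtain j where j: "lookup v (i, j) \<noteq> 0" ..
  have "lookup v (i', j') = 0" if "i' < i" for i' j'
    using not_less_Least[OF that[unfolded i_def]] by blast
  then have "lookup (v \<odot> u) (i, Suc j) = lookup v (i, j) * (1 - a * t j)"
    by (simp add: mult_u lookup_minus lookup_shift lookup_mult_x right_diff_distrib del: One_nat_def)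
  then show False
    using j at_neq_1 assms by simp
qed

text \<open>The elements of K[x] + C u, with the degree of the multiplier \<open>w\<close> kept
  below n - 1; the bound later makes the lift of \<open>w\<close> short enough for an induction on
  word length.\<close>

definition decomposable :: "nat \<Rightarrow> (nat \<times> nat \<Rightarrow>\<^sub>0 'k) set"
  where "decomposable n = {v. \<exists>f w. f \<in> coord_space {(i, j). j = 0} \<and>
    w \<in> coord_space {(i, j). Suc (i + j) < n} \<and> v = f + w \<odot> u}"

lemma decomposable_add: "v \<in> decomposable n \<Longrightarrow> w \<in> decomposable n \<Longrightarrow> v + w \<in> decomposable n"
proof -
  assume "v \<in> decomposable n" "w \<in> decomposable n"
  then obtain f f' p p' where
    "f \<in> coord_space {(i, j). j = 0}" "p \<in> coord_space {(i, j). Suc (i + j) < n}" "v = f + p \<odot> u"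
    "f' \<in> coord_space {(i, j). j = 0}" "p' \<in> coord_space {(i, j). Suc (i + j) < n}" "w = f' + p' \<odot> u"
    unfolding decomposable_def by blast
  then show "v + w \<in> decomposable n"
    unfolding decomposable_def
    by (intro CollectI exI[of _ "f + f'"] exI[of _ "p + p'"])
      (simp add: coord_space_closed mult_simps)
qed

lemma decomposable_scale: "v \<in> decomposable n \<Longrightarrow> r *\<^sub>k v \<in> decomposable n"
proof -
  assume "v \<in> decomposable n"
  then obtain f p where
    "f \<in> coord_space {(i, j). j = 0}" "p \<in> coord_space {(i, j). Suc (i + j) < n}" "v = f + p \<odot> u"
    unfolding decomposable_def by blast
  then show "r *\<^sub>k v \<in> decomposable n"
    unfolding decomposable_def
    by (intro CollectI exI[of _ "r *\<^sub>k f"] exI[of _ "r *\<^sub>k p"])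
      (simp add: coord_space_closed mult_simps scale_distribs)
qed

lemma decomposable_x: "f \<in> coord_space {(i, j). j = 0} \<Longrightarrow> f \<in> decomposable n"
  unfolding decomposable_def
  by (intro CollectI exI[of _ f] exI[of _ 0]) (simp add: coord_space_closed mult_simps)

lemma decomposable_mult_u:
  "w \<in> coord_space {(i, j). Suc (i + j) < n} \<Longrightarrow> w \<odot> u \<in> decomposable n"
  unfolding decomposable_def
  by (intro CollectI exI[of _ 0] exI[of _ w]) (simp add: coord_space_closed)

lemma decomposable_sum:
  assumes "\<And>z. z \<in> keys v \<Longrightarrow> single z 1 \<in> decomposable n"
  shows "v \<in> decomposable n"
proof -
  have "sum f X \<in> decomposable n" if "\<And>z. z \<in> X \<Longrightarrow> f z \<in> decomposable n"
    for X and f :: "nat \<times> nat \<Rightarrow> nat \<times> nat \<Rightarrow>\<^sub>0 'k"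
    using that
    by (induction X rule: infinite_finite_induct)
      (auto simp: decomposable_add decomposable_x coord_space_closed)
  from this[of "keys v" "\<lambda>z. lookup v z *\<^sub>k single z 1"] show ?thesis
    using assms by (simp only: decomposable_scale flip: expand_basis)
qed

text \<open>In x^i y^m u the monomial x^i y^(m+1) has the invertible coefficient 1 - a t_m, and all
  other monomials have a lower power of y, so induction on that power applies.\<close>

lemma xy_decomposable: "i + j < n \<Longrightarrow> xy i j \<in> decomposable n"
proof (induction j arbitrary: i rule: less_induct)
  case (less j)
  show ?case
  proof (cases j)
    case 0
    then show ?thesis
      by (intro decomposable_x) simp
  next
    case (Suc m)
    \<comment> \<open>\<open>e\<close> is x^i y^m x without its x^i y^(m+1) term. Its monomials have
      x-exponent at least \<open>i\<close> and the same total degree, hence a smaller power of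
      y.\<close>
    define e where "e = shift i 0 (\<tau> (xy m 1)) - t m *\<^sub>k xy i j"
    have "e \<in> decomposable n"
    proof (rule decomposable_sum)
      fix z assume z: "z \<in> keys e"
      obtain p q where pq: "z = (p, q)" by (cases z)
      have *: "z \<noteq> (i, j)"
        using z by (auto simp: e_def in_keys_iff lookup_minus lookup_shift Suc t_def)
      then have "i \<le> p" "lookup (\<tau> (xy m 1)) (p - i, q) \<noteq> 0"
        using z by (auto simp: e_def in_keys_iff lookup_minus lookup_shift pq lookup_single
            split: if_splits)
      with \<tau>_degree[OF this(2)] * have "q < j" "p + q < n"
        using less.prems by (auto simp: pq Suc)
      then show "single z 1 \<in> decomposable n"
        by (simp add: pq less.IH)
    qed
    moreover have "(1 - a * t m) *\<^sub>k xy i j = xy i m \<odot> u + a *\<^sub>k e"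
      by (rule poly_mapping_eqI) (simp add: mult_u e_def Suc mult_xy lookup_add lookup_minus
          lookup_single when_def algebra_simps)
    moreover have "xy i m \<odot> u \<in> decomposable n"
      using less.prems by (intro decomposable_mult_u) (simp add: Suc)
    ultimately have "(1 - a * t m) *\<^sub>k xy i j \<in> decomposable n"
      by (metis decomposable_add decomposable_scale)
    from decomposable_scale[OF this, of "inverse (1 - a * t m)"] show ?thesis
      using at_neq_1[of m] by simp
  qed
qed

text \<open>Write p = f + w u with f in K[x]. As u x = s y, the equation becomes f x + (w s + q) y =
  0; the first summand contains no y and the second is a multiple of y, so both vanish.\<close>

lemma mult_x_add_mult_y_eq_0:
  assumes p: "p \<in> coord_space {(i, j). i + j < n}" and eq: "p \<odot> xy 1 0 + q \<odot> xy 0 1 = 0"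
  obtains w where "w \<in> coord_space {(i, j). Suc (i + j) < n}" "p = w \<odot> u" "q = - (w \<odot> s)"
proof -
  have "p \<in> decomposable n"
    by (rule decomposable_sum) (use p in \<open>auto simp: coord_space_def xy_decomposable\<close>)
  then obtain f w where f: "f \<in> coord_space {(i, j). j = 0}"
    and w: "w \<in> coord_space {(i, j). Suc (i + j) < n}" and p_eq: "p = f + w \<odot> u"
    by (auto simp: decomposable_def)
  have fx: "f \<odot> xy 1 0 = shift 1 0 f"
    by (rule lin_eqI[where f = "\<lambda>f. f \<odot> xy 1 0"])
      (use f in \<open>auto simp: coord_space_def mult_xy \<tau>_0_left\<close>)
  have "shift 1 0 f + shift 0 1 (w \<odot> s + q) = p \<odot> xy 1 0 + q \<odot> xy 0 1"
    by (simp only: p_eq mult_add fx mult_assoc u_mult_x add.assoc flip: mult_y[of _ 1])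
  then have *: "shift 1 0 f + shift 0 1 (w \<odot> s + q) = 0"
    using eq by simp
  have "lookup f z = 0" for z
  proof (cases z)
    case (Pair i j)
    have "lookup (shift 1 0 f + shift 0 1 (w \<odot> s + q)) (Suc i, 0) = lookup f (i, 0)"
      by (simp add: lookup_add lookup_shift)
    then show ?thesis
      using * f by (cases j) (auto simp: Pair coord_space_iff)
  qed
  then have "f = 0"
    by (intro poly_mapping_eqI) simp
  have "lookup (w \<odot> s + q) z = 0" for z
  proof (cases z)
    case (Pair i j)
    have "lookup (shift 0 1 (w \<odot> s + q)) (i, Suc j) = lookup (w \<odot> s + q) (i, j)"
      by (simp add: lookup_shift)
    then show ?thesis
      using * \<open>f = 0\<close> by (simp add: Pair lin_zero[OF lin_shift])
  qed
  then have "w \<odot> s + q = 0"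
    by (intro poly_mapping_eqI) simp
  then have "q = - (w \<odot> s)"
    by (simp add: eq_neg_iff_add_eq_0 add.commute)
  then show thesis
    using that w p_eq \<open>f = 0\<close> by simp
qed

section \<open>Uniqueness of the extension\<close>

lemma unique_extension: "unique_extension_property polynomial_algebra polynomial_algebra \<tau>"
  unfolding unique_extension_property_def Let_def
proof (intro allI impI)
  fix n \<tau>'
  let ?A = "polynomial_algebra :: (nat, 'k) galg"
  let ?d = "tensor_deg (gdeg ?A) (gdeg ?A)"
  assume n: "n \<ge> 3"
    and graded: "graded_linear_map ?d ?d \<tau>'"
    and twist: "graded_twisting_to_degree ?A ?A n \<tau>'"
    and agree: "\<forall>i<n. deg_eq ?d i \<tau>' = deg_eq ?d i \<tau>"
  have lin': "lin \<tau>'"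
    using graded by (simp add: graded_linear_map_def)
  have d: "?d (i, j) = i + j" for i j
    by (simp add: tensor_deg_def polynomial_algebra_def)
  have deg_eq_xy: "deg_eq ?d i \<rho> (xy k l) = (if k + l = i then \<rho> (xy k l) else 0)"
    if "lin \<rho>" for \<rho> :: "(nat \<times> nat \<Rightarrow>\<^sub>0 'k) \<Rightarrow> (nat \<times> nat \<Rightarrow>\<^sub>0 'k)" and i k l
    by (simp add: deg_eq_def coord_proj_single d lin_zero[OF that])
  have low: "\<tau>' (xy k l) = \<tau> (xy k l)" if "k + l < n" for k l
    using agree that deg_eq_xy[OF lin', of "k + l" k l] deg_eq_xy[OF lin_\<tau>, of "k + l" k l] by simp
  \<comment> \<open>Cutting \<tau>' off above degree \<open>n\<close> gives the map that occurs in
    the twisting condition at degree \<open>n\<close>.\<close>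
  define \<sigma> where "\<sigma> = deg_le ?d n \<tau>'"
  have \<sigma>: "lin \<sigma>"
    unfolding \<sigma>_def deg_le_def by (rule lin_o[OF lin' lin_coord_proj])
  have \<sigma>_xy: "\<sigma> (xy k l) = \<tau>' (xy k l)" if "k + l \<le> n" for k l
    using that by (simp add: \<sigma>_def deg_le_def coord_proj_single d)
  have \<sigma>_low: "\<sigma> (xy k l) = \<tau> (xy k l)" if "k + l < n" for k l
    using that by (simp add: \<sigma>_xy low)
  have twist_xy: "\<tau>' (xy (j + l) (k + p)) =
      lin_ext (\<lambda>(i, m). tmult \<sigma> (\<sigma> (xy j i)) (\<sigma> (xy m p))) (\<sigma> (xy l k))"
    if deg: "j + l + k + p = n" for j l k p
  proof -
    have "single ((j, l), (k, p)) 1 \<in> homog (tensor_deg ?d ?d) n"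
      using deg by (simp add: homog_def tensor_deg_def polynomial_algebra_def)
    then have "deg_eq ?d n \<tau>' ((gmult ?A \<Otimes> gmult ?A) (single ((j, l), (k, p)) 1)) =
        ((gmult ?A \<Otimes> gmult ?A) \<circ> mid_map \<sigma> \<circ> (\<sigma> \<Otimes> \<sigma>) \<circ> mid_map \<sigma>) (single ((j, l), (k, p)) 1)"
      using twist unfolding graded_twisting_to_degree_def Let_def \<sigma>_def by blast
    then show ?thesis
      unfolding twisting_rhs_single[OF \<sigma>]
      using deg by (simp add: gmult_polynomial_single deg_eq_xy[OF lin'])
  qed
  \<comment> \<open>The discrepancy at y^(n-1) \<otimes> x; every other discrepancy in degree
    \<open>n\<close> turns out to be a multiple of it.\<close>
  define G where "G = \<tau>' (xy (n - 1) 1) - \<tau> (xy (n - 1) 1)"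
  \<comment> \<open>For a monomial x^i y^j of degree n - 1 with i > 0, the product with x involves
    only y^j x, of degree below \<open>n\<close>, where the two maps agree. Hence only y^(n-1)
    contributes.\<close>
  have mult_x_diff: "tmult \<sigma> v (xy 1 0) - v \<odot> xy 1 0 = lookup v (0, n - 1) *\<^sub>k G"
    if v: "\<And>i j. lookup v (i, j) \<noteq> 0 \<Longrightarrow> i + j = n - 1" for v
  proof (rule lin_eqI[where g = "\<lambda>v. lookup v (0, n - 1) *\<^sub>k G"])
    show "lin (\<lambda>v. tmult \<sigma> v (xy 1 0) - v \<odot> xy 1 0)"
      by (intro lin_minus_fun lin_tmult)
    show "lin (\<lambda>v. lookup v (0, n - 1) *\<^sub>k G)"
      by (simp add: lin_iff lookup_add scale_distribs)
    fix z assume z: "z \<in> keys v"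
    obtain i j where ij: "z = (i, j)" by (cases z)
    have deg: "i + j = n - 1"
      using z by (intro v) (simp add: ij in_keys_iff)
    show "tmult \<sigma> (single z 1) (xy 1 0) - single z 1 \<odot> xy 1 0 = lookup (single z 1) (0, n - 1) *\<^sub>k G"
    proof (cases "i = 0")
      case True
      then show ?thesis
        using deg n by (simp add: ij tmult_xy[OF \<sigma>] mult_xy \<sigma>_xy G_def del: One_nat_def)
    next
      case False
      then have "j + 1 < n"
        using deg n by linarith
      then show ?thesis
        using False by (simp add: ij tmult_xy[OF \<sigma>] mult_xy \<sigma>_low lookup_single del: One_nat_def)
    qed
  qed
  \<comment> \<open>Splitting off the last x reduces to degree n - 1, in which \<sigma> and \<tau>
    coincide.\<close>
  have diff: "\<tau>' (xy k (Suc l)) - \<tau> (xy k (Suc l)) = lookup (\<tau> (xy k l)) (0, n - 1) *\<^sub>k G"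
    if "k + l = n - 1" for k l
  proof -
    have "\<tau>' (xy k (Suc l)) = tmult \<sigma> (\<tau> (xy k l)) (xy 1 0)"
      using twist_xy[of k 0 l 1] that n by (simp add: \<sigma>_low \<tau>_0_left)
    moreover have "\<tau> (xy k (Suc l)) = \<tau> (xy k l) \<odot> xy 1 0"
      using \<tau>_mult_x[of k l 1] by simp
    ultimately show ?thesis
      using mult_x_diff[of "\<tau> (xy k l)"] \<tau>_degree[of k l] that by auto
  qed
  obtain m where m: "n = Suc (Suc m)" "m \<ge> 1"
    using n by (metis add_2_eq_Suc le_Suc_ex numeral_3_eq_3 Suc_le_mono plus_1_eq_Suc add_Suc_right One_nat_def le_add1)
  \<comment> \<open>The second way to compute y^(m+1) x: the relation for y x is applied first,
    which is available for \<sigma> because its degree 2 lies below \<open>n\<close>.\<close>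
  have "\<tau>' (xy (Suc m) 1) = tmult \<sigma> (xy 0 m) (\<tau> (xy 1 1))"
    using twist_xy[of m 1 0 1] m by (simp add: \<sigma>_low \<tau>_0_right)
  also have "\<dots> = a *\<^sub>k \<tau>' (xy m 2) + b *\<^sub>k shift 0 1 (\<tau> (xy m 1)) + c *\<^sub>k xy 0 (m + 2)"
    unfolding \<tau>_yx using m
    by (simp add: lin_add[OF lin_tmult(2)] lin_scale[OF lin_tmult(2)] tmult_xy[OF \<sigma>] \<sigma>_xy low
        \<tau>_0_right add.commute del: scale_simps One_nat_def)
  finally have "G = a *\<^sub>k (\<tau>' (xy m 2) - \<tau> (xy m 2))"
    using y_mult_\<tau>_yx[of m] m by (simp add: G_def scale_distribs del: One_nat_def)
  \<comment> \<open>Here m + 1 = n - 1, so the coefficient of y^(n-1) in y^m x is t_m.\<close>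
  also have "\<tau>' (xy m 2) - \<tau> (xy m 2) = t m *\<^sub>k G"
    using diff[of m 1] m by (simp add: t_def numeral_2_eq_2)
  finally have "(1 - a * t m) *\<^sub>k G = 0"
    by (simp add: scale_distribs)
  then have "inverse (1 - a * t m) *\<^sub>k (1 - a * t m) *\<^sub>k G = 0"
    by (simp only: scale_simps)
  then have G: "G = 0"
    using at_neq_1[of m] by simp
  have eq: "\<tau>' (xy k l) = \<tau> (xy k l)" if "k + l = n" for k l
  proof (cases l)
    case 0
    have "single k 1 \<in> homog (gdeg ?A) n"
      using that 0 by (simp add: homog_def polynomial_algebra_def)
    then have "\<tau>' (single k 1 \<otimes> gone ?A) = gone ?A \<otimes> single k 1"
      using twist unfolding graded_twisting_to_degree_def Let_def by blast
    then have "\<tau>' (xy k 0) = xy 0 k"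
      by (simp add: polynomial_algebra_def single_one[symmetric] del: single_one)
    then show ?thesis
      by (simp add: 0 \<tau>_0_right)
  next
    case (Suc l')
    then show ?thesis
      using diff[of k l'] that G by simp
  qed
  show "deg_eq ?d n \<tau>' = deg_eq ?d n \<tau>"
  proof (rule lin_eq)
    show "lin (deg_eq ?d n \<tau>')" "lin (deg_eq ?d n \<tau>)"
      unfolding deg_eq_def by (auto intro!: lin_o lin' lin_\<tau>)
    show "deg_eq ?d n \<tau>' (single z 1) = deg_eq ?d n \<tau> (single z 1)" for z
      by (cases z) (simp add: deg_eq_xy[OF lin'] deg_eq_xy[OF lin_\<tau>] eq)
  qed
qed

section \<open>The twisted tensor product as a connected graded algebra\<close>

abbreviation C :: "(nat \<times> nat, 'k) galg"
  where "C \<equiv> twisted_poly \<tau>"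

lemma gdeg_C: "gdeg C = (\<lambda>(i, j). i + j)"
  by (simp add: twisted_tensor_product_def tensor_deg_def polynomial_algebra_def)

lemma gone_C: "gone C = xy 0 0"
  by (simp add: twisted_tensor_product_def polynomial_algebra_def flip: single_one)

lemma gmult_C: "gmult C (v \<otimes> w) = v \<odot> w"
  by (simp add: tmult_def)

lemma mult_xy_degree: "xy i j \<odot> xy k l \<in> coord_space {z. gdeg C z = i + j + k + l}"
  using \<tau>_degree[of j k] by (fastforce simp: coord_space_iff mult_xy gdeg_C lookup_shift)

lemma graded_algebra_C: "graded_algebra C"
proof -
  have "gmult C v \<in> coord_space {z. gdeg C z = n}"
    if v: "v \<in> homog (tensor_deg (gdeg C) (gdeg C)) n" for v n
  proof (rule lin_image_in_coord_space[OF lin_gmult_twisted_poly v[unfolded homog_def]])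
    fix z assume z: "z \<in> {z. tensor_deg (gdeg C) (gdeg C) z = n}"
    obtain i j k l where ijkl: "z = ((i, j), (k, l))" by (metis surj_pair)
    have "gmult C (single z 1) = xy i j \<odot> xy k l"
      by (simp add: ijkl flip: gmult_C)
    then show "gmult C (single z 1) \<in> coord_space {z. gdeg C z = n}"
      using mult_xy_degree[of i j k l] z by (simp add: ijkl tensor_deg_def gdeg_C add.assoc)
  qed
  then show ?thesis
    unfolding graded_algebra_def graded_linear_map_def
    by (auto simp: gmult_C gone_C mult_assoc) (auto simp: homog_def gdeg_C)
qed

lemma connected_C: "connected_graded_algebra C"
proof -
  have "v = lookup v (0, 0) *\<^sub>k xy 0 0" if "v \<in> homog (gdeg C) 0" for v :: "nat \<times> nat \<Rightarrow>\<^sub>0 'k"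
    using that
    by (intro poly_mapping_eqI) (fastforce simp: homog_def gdeg_C coord_space_iff lookup_single when_def)
  moreover have "r *\<^sub>k gone C \<in> homog (gdeg C) 0" for r :: 'k
    by (simp add: homog_def gdeg_C gone_C)
  moreover have "gone C \<noteq> 0"
    by (metis gone_C lookup_single_eq lookup_zero one_neq_zero)
  ultimately show ?thesis
    unfolding connected_graded_algebra_def gone_C using graded_algebra_C by blast
qed

section \<open>Words in x and y and the quadratic relation\<close>

lemma degree_1: "{z. gdeg C z = 1} = {(1, 0), (0, 1)}"
  by (auto simp: gdeg_C add_is_1)

lemma tensor_algebra_C: "tensor_algebra C = coord_space (lists {(1, 0), (0, 1)})"
  by (simp only: tensor_algebra_def degree_1)

lemma word_eval_C_mult: "word_eval C (word_mult v w) = word_eval C v \<odot> word_eval C w"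
  by (simp add: word_eval_mult[OF graded_algebra_C] gmult_C)

lemma word_eval_C_Nil: "word_eval C (single [] 1) = xy 0 0"
  by (simp add: word_eval_single gone_C)

lemma word_eval_C_Cons: "word_eval C (single (z # w) 1) = single z 1 \<odot> word_eval C (single w 1)"
  by (simp add: word_eval_single gmult_C)

lemma word_eval_C_letter: "word_eval C (single [z] 1) = single z 1"
  by (simp only: word_eval_C_Cons word_eval_C_Nil mult_one)

lemma word_eval_C_degree:
  "word_eval C (single w 1) \<in> coord_space {z. gdeg C z = (\<Sum>i\<leftarrow>w. gdeg C i)}"
proof (induction w)
  case Nil
  then show ?case
    by (simp add: word_eval_C_Nil gdeg_C)
next
  case (Cons i w)
  obtain k l where i: "i = (k, l)" by (cases i)
  show ?case
    unfolding word_eval_C_Cons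
  proof (rule lin_image_in_coord_space[OF lin_tmult(2) Cons])
    fix z assume "z \<in> {z. gdeg C z = (\<Sum>i\<leftarrow>w. gdeg C i)}"
    then show "single i 1 \<odot> single z 1 \<in> coord_space {z. gdeg C z = (\<Sum>i\<leftarrow>i # w. gdeg C i)}"
      using mult_xy_degree[of k l "fst z" "snd z"] by (cases z) (simp add: i gdeg_C add.assoc)
  qed
qed

definition word_of :: "nat \<times> nat \<Rightarrow> (nat \<times> nat) list"
  where "word_of = (\<lambda>(i, j). replicate i (1, 0) @ replicate j (0, 1))"

text \<open>A linear section of \<open>word_eval C\<close>, built from the normal-form
  words.\<close>

definition lift :: "(nat \<times> nat \<Rightarrow>\<^sub>0 'k) \<Rightarrow> ((nat \<times> nat) list \<Rightarrow>\<^sub>0 'k)"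
  where "lift = lin_ext (\<lambda>z. single (word_of z) 1)"

lemma word_eval_C_word_of: "word_eval C (single (word_of (i, j)) 1) = xy i j"
proof (induction i)
  case 0
  have "word_eval C (single (replicate j (0, 1)) 1) = xy 0 j"
  proof (induction j)
    case (Suc j)
    then show ?case
      by (simp add: word_eval_C_Cons mult_xy \<tau>_0_right)
  qed (simp add: word_eval_C_Nil)
  then show ?case
    by (simp add: word_of_def)
next
  case (Suc i)
  then show ?case
    by (simp add: word_of_def word_eval_C_Cons)
qed

lemma word_eval_lift: "word_eval C (lift v) = v"
  by (rule lin_eqI[where f = "\<lambda>v. word_eval C (lift v)"])
    (auto simp: lift_def word_eval_C_word_of intro: lin_comp)

text \<open>The length filtration along which the kernel of \<open>word_eval C\<close> is treated by
  induction.\<close>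

definition short_words :: "nat \<Rightarrow> (nat \<times> nat) list set"
  where "short_words n = {w \<in> lists {(1, 0), (0, 1)}. length w < n}"

lemma word_eval_short:
  assumes "v \<in> coord_space (short_words n)"
  shows "word_eval C v \<in> coord_space {(i, j). i + j < n}"
proof (rule lin_image_in_coord_space[OF lin_word_eval assms])
  fix w assume w: "w \<in> short_words n"
  have "(\<Sum>i\<leftarrow>w. gdeg C i) = length w" if "w \<in> lists {(1, 0), (0, 1)}" for w
    using that by induction (auto simp: gdeg_C)
  then show "word_eval C (single w 1) \<in> coord_space {(i, j). i + j < n}"
    using word_eval_C_degree[of w] w by (auto simp: coord_space_def gdeg_C short_words_def)
qed

lemma lift_short:
  assumes "v \<in> coord_space {(i, j). Suc (i + j) < n}"
  shows "lift v \<in> coord_space {w \<in> lists {(1, 0), (0, 1)}. Suc (length w) < n}"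
  unfolding lift_def
  by (rule lin_ext_in_coord_space[OF assms]) (auto simp: word_of_def)

text \<open>Letters are split off on the right so that, apart from the empty word, evaluation gives
  an expression p x + q y, the shape treated by \<open>mult_x_add_mult_y_eq_0\<close>.\<close>

lemma split_last_letter:
  fixes v :: "(nat \<times> nat) list \<Rightarrow>\<^sub>0 'k"
  assumes "v \<in> coord_space (short_words (Suc n))"
  obtains p q where "p \<in> coord_space (short_words n)" "q \<in> coord_space (short_words n)"
    "v = lookup v [] *\<^sub>k single [] 1 + word_mult p (single [(1, 0)] 1) + word_mult q (single [(0, 1)] 1)"
proof -
  define strip :: "nat \<times> nat \<Rightarrow> ((nat \<times> nat) list \<Rightarrow>\<^sub>0 'k) \<Rightarrow> ((nat \<times> nat) list \<Rightarrow>\<^sub>0 'k)" where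
    "strip z = lin_ext (\<lambda>w. if w \<noteq> [] \<and> last w = z then single (butlast w) 1 else 0)"
    for z
  have lin_strip: "lin (strip z)" for z
    by (simp add: strip_def)
  have "strip z v \<in> coord_space (short_words n)" for z
    unfolding strip_def
  proof (rule lin_ext_in_coord_space[OF assms])
    fix w assume "w \<in> short_words (Suc n)"
    then show "(if w \<noteq> [] \<and> last w = z then single (butlast w) 1 else 0) \<in> coord_space (short_words n)"
      by (cases w rule: rev_cases) (auto simp: short_words_def coord_space_closed)
  qed
  moreover have "v = lookup v [] *\<^sub>k single [] 1 + word_mult (strip (1, 0) v) (single [(1, 0)] 1) +
      word_mult (strip (0, 1) v) (single [(0, 1)] 1)"
  proof (rule lin_eqI[where g = "\<lambda>v. lookup v [] *\<^sub>k single [] 1 +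
      word_mult (strip (1, 0) v) (single [(1, 0)] 1) + word_mult (strip (0, 1) v) (single [(0, 1)] 1)"])
    have "lin (\<lambda>v. lookup v [] *\<^sub>k single [] 1)"
      by (simp add: lin_iff lookup_add scale_distribs single_add distrib_right)
    then show "lin (\<lambda>v. lookup v [] *\<^sub>k single [] 1 +
        word_mult (strip (1, 0) v) (single [(1, 0)] 1) + word_mult (strip (0, 1) v) (single [(0, 1)] 1))"
      by (intro lin_plus lin_comp[OF lin_word_mult(1) lin_strip])
    fix w assume "w \<in> keys v"
    then have "w \<in> lists {(1, 0), (0, 1)}"
      using assms by (auto simp: coord_space_def short_words_def)
    then show "single w 1 = lookup (single w 1) [] *\<^sub>k single [] 1 +
        word_mult (strip (1, 0) (single w 1)) (single [(1, 0)] 1) +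
        word_mult (strip (0, 1) (single w 1)) (single [(0, 1)] (1::'k))"
      by (cases w rule: rev_cases) (auto simp: strip_def lookup_single word_mult_simps)
  qed simp
  ultimately show thesis
    using that by blast
qed

lemma lookup_mult_x_0: "lookup (v \<odot> xy 1 0) (0, 0) = 0"
proof -
  have "lookup (single z 1 \<odot> xy 1 0) (0, 0) = 0" for z
    using \<tau>_degree[of "snd z" 1 0 0] by (cases z) (auto simp: mult_xy lookup_shift)
  then show ?thesis
    by (subst lookup_lin[OF lin_tmult(1)]) simp
qed

definition u_word :: "(nat \<times> nat) list \<Rightarrow>\<^sub>0 'k"
  where "u_word = single [(0, 1)] 1 - a *\<^sub>k single [(1, 0)] 1"

definition s_word :: "(nat \<times> nat) list \<Rightarrow>\<^sub>0 'k"
  where "s_word = b *\<^sub>k single [(1, 0)] 1 + c *\<^sub>k single [(0, 1)] 1"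

definition relation :: "(nat \<times> nat) list \<Rightarrow>\<^sub>0 'k"
  where "relation = word_mult u_word (single [(1, 0)] 1) - word_mult s_word (single [(0, 1)] 1)"

lemma word_eval_u: "word_eval C u_word = u"
  by (simp add: lin_diff[OF lin_word_eval] lin_scale[OF lin_word_eval] word_eval_C_letter u_def
      u_word_def del: scale_simps)

lemma word_eval_s: "word_eval C s_word = s"
  by (simp add: lin_add[OF lin_word_eval] lin_scale[OF lin_word_eval] word_eval_C_letter s_def
      s_word_def del: scale_simps)

lemma word_eval_relation: "word_eval C relation = 0"
  by (simp add: relation_def lin_diff[OF lin_word_eval] word_eval_C_mult word_eval_u word_eval_s
      word_eval_C_letter u_mult_x del: mult_y One_nat_def scale_simps)

lemma relation_in: "relation \<in> coord_space {w \<in> lists {(1, 0), (0, 1)}. length w = 2}"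
  unfolding relation_def u_word_def s_word_def
  by (simp add: word_mult_simps coord_space_closed del: scale_simps)

text \<open>Induction on the length bound. A kernel element splits as p x + q y, and the evaluations
  of \<open>p\<close> and \<open>q\<close> are w u and - w s. Subtracting a lift of these leaves
  shorter kernel elements, and the subtracted part is a left multiple of
  \<open>relation\<close>.\<close>

lemma kernel_in_ideal:
  assumes J: "two_sided_ideal C J" "relation \<in> J"
  shows "v \<in> coord_space (short_words n) \<Longrightarrow> word_eval C v = 0 \<Longrightarrow> v \<in> J"
proof (induction n arbitrary: v)
  case 0
  then have "v = 0"
    by (simp add: coord_space_def short_words_def)
  then show ?case
    using J by (simp add: two_sided_ideal_def subspace_iff)
next
  case (Suc n)
  let ?X = "single [(1, 0)] (1::'k)" and ?Y = "single [(0, 1)] (1::'k)"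
  obtain p q where p: "p \<in> coord_space (short_words n)" and q: "q \<in> coord_space (short_words n)"
    and v: "v = lookup v [] *\<^sub>k single [] 1 + word_mult p ?X + word_mult q ?Y"
    using split_last_letter[OF Suc.prems(1)] by blast
  have ev: "word_eval C v =
      lookup v [] *\<^sub>k xy 0 0 + word_eval C p \<odot> xy 1 0 + word_eval C q \<odot> xy 0 1"
    by (subst v) (simp only: lin_add[OF lin_word_eval] lin_scale[OF lin_word_eval] word_eval_C_mult
        word_eval_C_Nil word_eval_C_letter)
  \<comment> \<open>The products with x and y have no term in degree zero, so this coefficient
    isolates the empty word.\<close>
  then have "lookup (lookup v [] *\<^sub>k xy 0 0 + word_eval C p \<odot> xy 1 0 + word_eval C q \<odot> xy 0 1) (0, 0) = 0"
    using Suc.prems(2) by simp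
  then have v0: "lookup v [] = 0"
    by (simp add: lookup_add lookup_single lookup_mult_x_0 lookup_shift del: One_nat_def)
  then have "word_eval C p \<odot> xy 1 0 + word_eval C q \<odot> xy 0 1 = 0"
    using ev Suc.prems(2) by simp
  then obtain w where w: "w \<in> coord_space {(i, j). Suc (i + j) < n}"
    "word_eval C p = w \<odot> u" "word_eval C q = - (w \<odot> s)"
    using mult_x_add_mult_y_eq_0[OF word_eval_short[OF p]] by blast
  \<comment> \<open>By the degree bound on \<open>w\<close>, the products of its lift with
    \<open>u_word\<close> and \<open>s_word\<close> have length below \<open>n\<close>, so the
    induction hypothesis applies to the corrected \<open>p\<close> and \<open>q\<close>.\<close>
  define W where "W = lift w"
  have W: "W \<in> coord_space {w \<in> lists {(1, 0), (0, 1)}. Suc (length w) < n}"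
    unfolding W_def by (rule lift_short[OF w(1)])
  have US: "u_word \<in> coord_space {[(1, 0)], [(0, 1)]}" "s_word \<in> coord_space {[(1, 0)], [(0, 1)]}"
    unfolding u_word_def s_word_def by (auto intro!: coord_space_closed simp del: scale_simps)
  have "p - word_mult W u_word \<in> J"
  proof (rule Suc.IH)
    show "p - word_mult W u_word \<in> coord_space (short_words n)"
      by (rule coord_space_closed(3)[OF p word_mult_in_coord_space[OF W US(1)]])
        (auto simp: short_words_def)
    show "word_eval C (p - word_mult W u_word) = 0"
      by (simp only: lin_diff[OF lin_word_eval] word_eval_C_mult word_eval_u W_def word_eval_lift w diff_self)
  qed
  moreover have "q + word_mult W s_word \<in> J"
  proof (rule Suc.IH)
    show "q + word_mult W s_word \<in> coord_space (short_words n)"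
      by (rule coord_space_closed(2)[OF q word_mult_in_coord_space[OF W US(2)]])
        (auto simp: short_words_def)
    show "word_eval C (q + word_mult W s_word) = 0"
      by (simp only: lin_add[OF lin_word_eval] word_eval_C_mult word_eval_s W_def word_eval_lift w
          add.left_inverse)
  qed
  moreover have "?X \<in> tensor_algebra C" "?Y \<in> tensor_algebra C" "W \<in> tensor_algebra C"
    using W by (auto simp: tensor_algebra_C coord_space_def)
  \<comment> \<open>Adding \<open>W\<close> times \<open>relation\<close> cancels the corrections
    and leaves \<open>v\<close>.\<close>
  ultimately have "word_mult (p - word_mult W u_word) ?X + word_mult (q + word_mult W s_word) ?Y +
      word_mult W relation \<in> J"
    using J by (simp add: two_sided_ideal_def subspace_iff del: scale_simps)
  also have "word_mult (p - word_mult W u_word) ?X + word_mult (q + word_mult W s_word) ?Y +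
      word_mult W relation = word_mult p ?X + word_mult q ?Y"
    by (simp only: relation_def word_mult_simps word_mult_assoc) (simp add: algebra_simps)
  also have "\<dots> = v"
    using v unfolding v0 scale_simps(1) add_0 ..
  finally show ?case .
qed

lemma quadratic_C: "quadratic_algebra C"
proof -
  define K where "K = {v \<in> tensor_algebra C. word_eval C v = 0}"
  have "lift v \<in> tensor_algebra C" for v
    unfolding tensor_algebra_C lift_def
    by (rule lin_ext_in_coord_space[of v UNIV]) (auto simp: coord_space_def word_of_def)
  then have "word_eval C ` tensor_algebra C = UNIV"
    by (metis word_eval_lift image_eqI UNIV_eq_I)
  \<comment> \<open>The kernel is itself a two-sided ideal, because \<open>word_eval C\<close> is
    multiplicative.\<close>
  moreover have "two_sided_ideal C hull (K \<inter> homog length 2) \<subseteq> K"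
  proof (rule hull_minimal)
    have "word_mult v w \<in> tensor_algebra C" if "v \<in> tensor_algebra C" "w \<in> tensor_algebra C" for v w
      using that unfolding tensor_algebra_C by (rule word_mult_in_coord_space) simp
    then show "two_sided_ideal C K"
      by (auto simp: two_sided_ideal_def K_def subspace_iff word_eval_C_mult mult_zero
          lin_zero[OF lin_word_eval] lin_add[OF lin_word_eval] lin_scale[OF lin_word_eval])
        (auto simp: tensor_algebra_C coord_space_closed)
  qed auto
  moreover have "K \<subseteq> two_sided_ideal C hull (K \<inter> homog length 2)"
    unfolding hull_def
  \<comment> \<open>The hull is the intersection of all ideals containing the quadratic part of the
    kernel, and each of them contains \<open>relation\<close>.\<close>
  proof (intro subsetI InterI)
    fix v J assume v: "v \<in> K" and J: "J \<in> {J. two_sided_ideal C J \<and> K \<inter> homog length 2 \<subseteq> J}"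
    have "relation \<in> K \<inter> homog length 2"
      using relation_in word_eval_relation
      by (auto simp: K_def homog_def tensor_algebra_C coord_space_def)
    moreover obtain n where "\<forall>w\<in>keys v. length w < n"
      using finite_nat_set_iff_bounded[of "length ` keys v"] by auto
    then have "v \<in> coord_space (short_words n)"
      using v by (auto simp: K_def tensor_algebra_C coord_space_def short_words_def)
    ultimately show "v \<in> J"
      using kernel_in_ideal[of J v n] v J by (auto simp: K_def)
  qed
  ultimately show ?thesis
    using connected_C by (auto simp: quadratic_algebra_def Let_def K_def)
qed

section \<open>A linear free resolution of the residue field\<close>

abbreviation aug :: "(nat \<times> nat \<Rightarrow>\<^sub>0 'k) \<Rightarrow> (nat \<times> nat \<Rightarrow>\<^sub>0 'k)"
  where "aug \<equiv> coord_proj {z. gdeg C z = 0}"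

text \<open>Terms of positive degree in \<open>w\<close> contribute only positive degrees to the
  product, so they may be dropped beforehand. This makes \<open>aug\<close> compatible with the
  action on the residue module.\<close>

lemma aug_mult: "aug (v \<odot> aug w) = aug (v \<odot> w)"
proof (rule bilin_eqI[where f = "\<lambda>v w. aug (v \<odot> aug w)" and g = "\<lambda>v w. aug (v \<odot> w)"])
  show "lin (\<lambda>v. aug (v \<odot> aug w))" for w
    by (rule lin_comp[OF lin_coord_proj lin_tmult(1)])
  show "lin (\<lambda>v. aug (v \<odot> w))" for w
    by (rule lin_comp[OF lin_coord_proj lin_tmult(1)])
  show "lin (\<lambda>w. aug (v \<odot> w))" for v
    by (rule lin_comp[OF lin_coord_proj lin_tmult(2)])
  show "lin (\<lambda>w. aug (v \<odot> aug w))" for v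
    by (rule lin_comp[OF lin_coord_proj lin_comp[OF lin_tmult(2) lin_coord_proj]])
  fix y z :: "nat \<times> nat"
  obtain i j k l where yz: "y = (i, j)" "z = (k, l)" by (metis surj_pair)
  have "aug (single y 1 \<odot> single z 1) = 0" if "gdeg C z \<noteq> 0"
    using that mult_xy_degree[of i j k l]
    by (intro poly_mapping_eqI) (auto simp: yz lookup_coord_proj coord_space_iff gdeg_C)
  then show "aug (single y 1 \<odot> aug (single z 1)) = aug (single y 1 \<odot> single z 1)"
    by (simp add: coord_proj_single mult_zero lin_zero[OF lin_coord_proj])
qed

lemma aug_mult_xy: "0 < k + l \<Longrightarrow> aug (v \<odot> xy k l) = 0"
  using aug_mult[of v "xy k l"]
  by (simp add: coord_proj_single gdeg_C mult_zero lin_zero[OF lin_coord_proj] split: if_splits)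

text \<open>The augmentation ideal is C x + C y: x^i y^j ends in y when j > 0, and x^i ends in x
  when i > 0.\<close>

lemma aug_eq_0:
  assumes "aug v = 0"
  obtains p q where "v = p \<odot> xy 1 0 + q \<odot> xy 0 1"
proof -
  define p where "p v = lin_ext (\<lambda>(i, j). if j = 0 \<and> i > 0 then xy (i - 1) 0 else 0) v"
    for v :: "nat \<times> nat \<Rightarrow>\<^sub>0 'k"
  define q where "q v = lin_ext (\<lambda>(i, j). if j > 0 then xy i (j - 1) else 0) v"
    for v :: "nat \<times> nat \<Rightarrow>\<^sub>0 'k"
  have lin_pq: "lin p" "lin q"
    by (simp_all add: p_def[abs_def] q_def[abs_def])
  have "v = p v \<odot> xy 1 0 + q v \<odot> xy 0 1 + aug v"
  proof (rule lin_eqI[where g = "\<lambda>v. p v \<odot> xy 1 0 + q v \<odot> xy 0 1 + aug v"])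
    show "lin (\<lambda>v. p v \<odot> xy 1 0 + q v \<odot> xy 0 1 + aug v)"
      by (rule lin_plus[OF lin_plus[OF lin_comp[OF lin_tmult(1) lin_pq(1)]
            lin_comp[OF lin_tmult(1) lin_pq(2)]] lin_coord_proj])
    fix z :: "nat \<times> nat"
    obtain i j where z: "z = (i, j)" by (cases z)
    show "single z 1 = p (single z 1) \<odot> xy 1 0 + q (single z 1) \<odot> xy 0 1 + aug (single z 1)"
      by (cases i; cases j)
        (simp_all add: z p_def q_def coord_proj_single gdeg_C mult_zero mult_xy \<tau>_0_left
          lin_zero[OF lin_shift])
  qed simp
  then show thesis
    using that assms by simp
qed

text \<open>The ranks are 1, 2, 1 and then 0: the unit, the two variables, and the relation,
  labelled by its word y x.\<close>

definition labels :: "nat \<Rightarrow> (nat \<times> nat) list set"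
  where "labels n =
    (if n = 0 then {[]} else if n = 1 then {[(1, 0)], [(0, 1)]}
     else if n = 2 then {[(0, 1), (1, 0)]} else {})"

text \<open>The images of the generators under the differential; a label of length two goes to the
  pair (u, -s) read off from u x - s y = 0.\<close>

fun boundary :: "(nat \<times> nat) list \<Rightarrow> ((nat \<times> nat) \<times> (nat \<times> nat) list \<Rightarrow>\<^sub>0 'k)"
  where
    "boundary [z] = single z 1 \<otimes> single [] 1"
  | "boundary [_, _] = u \<otimes> single [(1, 0)] 1 - s \<otimes> single [(0, 1)] 1"
  | "boundary _ = 0"

abbreviation P :: "nat \<Rightarrow> ((nat \<times> nat) \<times> (nat \<times> nat) list \<Rightarrow>\<^sub>0 'k) set"
  where "P n \<equiv> coord_space (UNIV \<times> labels n)"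

abbreviation \<delta> :: "((nat \<times> nat) \<times> (nat \<times> nat) list \<Rightarrow>\<^sub>0 'k) \<Rightarrow> ((nat \<times> nat) \<times> (nat \<times> nat) list \<Rightarrow>\<^sub>0 'k)"
  where "\<delta> \<equiv> free_ext C boundary"

definition \<epsilon> :: "((nat \<times> nat) \<times> (nat \<times> nat) list \<Rightarrow>\<^sub>0 'k) \<Rightarrow> (nat \<times> nat \<Rightarrow>\<^sub>0 'k)"
  where "\<epsilon> p = aug (component [] p)"

lemma P_0: "P 0 = {v \<otimes> single [] 1 |v. True}"
proof (intro subset_antisym subsetI)
  fix p assume "p \<in> P 0"
  from sum_components[OF this] show "p \<in> {v \<otimes> single [] 1 |v. True}"
    by (auto simp: labels_def)
qed (auto simp: labels_def coord_space_iff lookup_tensor lookup_single)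

lemma P_1: "P 1 = {v \<otimes> single [(1, 0)] 1 + w \<otimes> single [(0, 1)] 1 |v w. True}"
proof (intro subset_antisym subsetI)
  fix p assume "p \<in> P 1"
  from sum_components[OF this] show "p \<in> {v \<otimes> single [(1, 0)] 1 + w \<otimes> single [(0, 1)] 1 |v w. True}"
    by (auto simp: labels_def)
qed (auto simp: labels_def coord_space_iff lookup_tensor lookup_single lookup_add)

lemma P_2: "P 2 = {v \<otimes> single [(0, 1), (1, 0)] 1 |v. True}"
proof (intro subset_antisym subsetI)
  fix p assume "p \<in> P 2"
  from sum_components[OF this] show "p \<in> {v \<otimes> single [(0, 1), (1, 0)] 1 |v. True}"
    by (auto simp: labels_def)
qed (auto simp: labels_def coord_space_iff lookup_tensor lookup_single)

lemma P_ge_3: "n \<ge> 3 \<Longrightarrow> P n = {0}"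
  by (auto simp: labels_def coord_space_def)

lemma \<delta>_letter: "\<delta> (v \<otimes> single [z] 1) = (v \<odot> single z 1) \<otimes> single [] 1"
  by (simp add: free_ext_tensor[OF graded_algebra_C] free_act_tensor[OF graded_algebra_C] gmult_C
      del: tensor_single)

lemma \<delta>_1: "\<delta> (v \<otimes> single [(1, 0)] 1 + w \<otimes> single [(0, 1)] 1) =
    (v \<odot> xy 1 0 + w \<odot> xy 0 1) \<otimes> single [] 1"
  by (simp only: lin_add[OF lin_free_ext] \<delta>_letter lin_add[OF lin_tensor_left])

lemma \<delta>_2: "\<delta> (v \<otimes> single [z, z'] 1) =
    (v \<odot> u) \<otimes> single [(1, 0)] 1 - (v \<odot> s) \<otimes> single [(0, 1)] 1"
  by (simp add: free_ext_tensor[OF graded_algebra_C] lin_diff[OF lin_free_act(2)[OF graded_algebra_C]]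
      free_act_tensor[OF graded_algebra_C] gmult_C)

lemma \<epsilon>_tensor: "\<epsilon> (v \<otimes> single [] 1) = aug v"
proof -
  have "component [] (v \<otimes> single ([] :: (nat \<times> nat) list) 1) = v"
    unfolding component_def
    by (rule lin_eqI[where f = "\<lambda>v. lin_ext _ (v \<otimes> single [] 1)"]) (auto intro: lin_comp)
  then show ?thesis
    by (simp add: \<epsilon>_def)
qed

lemma tensor_single_eq_0: "v \<otimes> single w (1::'k::field) = 0 \<longleftrightarrow> v = 0"
proof
  assume *: "v \<otimes> single w (1::'k) = 0"
  have "lookup v i = lookup (v \<otimes> single w (1::'k)) (i, w)" for i
    by (simp add: lookup_tensor)
  then show "v = 0"
    by (intro poly_mapping_eqI) (simp add: *)
qed (simp add: lin_zero[OF lin_tensor_left])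

lemma u_degree: "u \<in> coord_space {z. gdeg C z = 1}"
  and s_degree: "s \<in> coord_space {z. gdeg C z = 1}"
  unfolding u_def s_def by (auto intro!: coord_space_closed simp: gdeg_C simp del: scale_simps)

text \<open>The coefficients in \<open>boundary\<close> have degree one, which makes up for the drop
  of the generator degree from n + 1 to n.\<close>

lemma \<delta>_hom:
  "graded_module_hom (free_act C) (UNIV \<times> labels (Suc n)) (free_deg C (Suc n))
     (free_act C) (UNIV \<times> labels n) (free_deg C n) \<delta>"
proof -
  have basis: "\<delta> (single (i, w) 1) \<in> coord_space {y \<in> UNIV \<times> labels n. free_deg C n y = gdeg C i + Suc n}"
    if w: "w \<in> labels (Suc n)" for i w
  proof -
    have eq: "single (i, w) (1::'k) = single i 1 \<otimes> single w 1"
      by simp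
    have deg: "single i 1 \<odot> v \<in> coord_space {z. gdeg C z = gdeg C i + 1}"
      if "v \<in> coord_space {z. gdeg C z = 1}" for v
    proof (rule lin_image_in_coord_space[OF lin_tmult(2) that])
      fix z assume "z \<in> {z. gdeg C z = 1}"
      then show "single i 1 \<odot> single z 1 \<in> coord_space {z. gdeg C z = gdeg C i + 1}"
        using mult_xy_degree[of "fst i" "snd i" "fst z" "snd z"]
        by (cases i; cases z) (simp add: gdeg_C add.assoc)
    qed
    have tensor: "v \<otimes> single w' 1 \<in> coord_space {y \<in> UNIV \<times> labels n. free_deg C n y = gdeg C i + Suc n}"
      if "v \<in> coord_space {z. gdeg C z = gdeg C i + 1}" "w' \<in> labels n" for v w'
      using tensor_coord_space[OF that(1), of w' 1] that(2)
      by (auto simp: coord_space_def free_deg_def tensor_deg_def)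
    consider "n = 0" | "n = 1" | "n \<ge> 2"
      by linarith
    then show ?thesis
    proof cases
      case 1
      then have "w = [(1, 0)] \<or> w = [(0, 1)]"
        using w by (simp add: labels_def)
      moreover have "single z 1 \<in> coord_space {z. gdeg C z = 1}" if "z = (1, 0) \<or> z = (0, 1)" for z
        using that by (auto simp: gdeg_C)
      ultimately obtain z where "w = [z]" "single z 1 \<in> coord_space {z. gdeg C z = 1}"
        by blast
      then show ?thesis
        unfolding eq by (simp only: \<delta>_letter) (intro tensor deg; simp add: 1 labels_def)
    next
      case 2
      then have "w = [(0, 1), (1, 0)]"
        using w by (simp add: labels_def)
      then show ?thesis
        unfolding eq using u_degree s_degree
        by (simp only: \<delta>_2) (intro coord_space_closed tensor deg; simp add: 2 labels_def)
    next
      case 3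
      then show ?thesis
        using w by (simp add: labels_def)
    qed
  qed
  have "\<delta> p \<in> coord_space {y \<in> UNIV \<times> labels n. free_deg C n y = m}"
    if "p \<in> coord_space {x \<in> UNIV \<times> labels (Suc n). free_deg C (Suc n) x = m}" for p m
    by (rule lin_image_in_coord_space[OF lin_free_ext that])
      (use basis in \<open>auto simp: free_deg_def tensor_deg_def\<close>)
  then show ?thesis
    by (auto simp: graded_module_hom_def lin_add[OF lin_free_ext] free_ext_act[OF graded_algebra_C])
qed

lemma \<epsilon>_hom:
  "graded_module_hom (free_act C) (UNIV \<times> labels 0) (free_deg C 0)
     (residue_act C) {i. gdeg C i = 0} (gdeg C) \<epsilon>"
  unfolding graded_module_hom_def P_0
proof (intro conjI ballI allI)
  have lin: "lin \<epsilon>"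
    unfolding \<epsilon>_def[abs_def] component_def by (rule lin_comp[OF lin_coord_proj lin_lin_ext])
  show "\<epsilon> (p + q) = \<epsilon> p + \<epsilon> q" for p q
    by (rule lin_add[OF lin])
  show "\<epsilon> (free_act C r p) = residue_act C r (\<epsilon> p)"
    if "p \<in> {v \<otimes> single [] 1 |v. True}" for r p
    using that
    by (auto simp: free_act_tensor[OF graded_algebra_C] \<epsilon>_tensor residue_act_def gmult_C aug_mult)
  have "\<epsilon> p \<in> coord_space {y \<in> {i. gdeg C i = 0}. gdeg C y = m}"
    if "p \<in> coord_space {x \<in> UNIV \<times> labels 0. free_deg C 0 x = m}" for p m
  proof (rule lin_image_in_coord_space[OF lin that])
    fix x assume "x \<in> {x \<in> UNIV \<times> labels 0. free_deg C 0 x = m}"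
    then obtain i where i: "x = (i, [])" "gdeg C i = m"
      by (auto simp: labels_def free_deg_def tensor_deg_def)
    then have "\<epsilon> (single x 1) = aug (single i 1)"
      by (simp flip: \<epsilon>_tensor)
    then show "\<epsilon> (single x 1) \<in> coord_space {y \<in> {i. gdeg C i = 0}. gdeg C y = m}"
      using i by (simp add: coord_proj_single coord_space_closed)
  qed
  then show "\<epsilon> ` coord_space {x \<in> UNIV \<times> labels 0. free_deg C 0 x = m} \<subseteq>
      coord_space {y \<in> {i. gdeg C i = 0}. gdeg C y = m}" for m
    by blast
qed

lemma \<epsilon>_P_0: "\<epsilon> ` P 0 = homog (gdeg C) 0"
proof
  have "aug v \<in> homog (gdeg C) 0" for v
    by (simp add: homog_def coord_space_iff lookup_coord_proj)
  then show "\<epsilon> ` P 0 \<subseteq> homog (gdeg C) 0"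
    by (auto simp: P_0 \<epsilon>_tensor)
  show "homog (gdeg C) 0 \<subseteq> \<epsilon> ` P 0"
  proof
    fix v :: "nat \<times> nat \<Rightarrow>\<^sub>0 'k"
    assume "v \<in> homog (gdeg C) 0"
    then have "v = \<epsilon> (v \<otimes> single [] 1)"
      by (simp add: \<epsilon>_tensor homog_def coord_proj_id)
    then show "v \<in> \<epsilon> ` P 0"
      unfolding P_0 by blast
  qed
qed

text \<open>By \<open>aug_eq_0\<close> an element without degree-zero part is a combination of x and
  y; conversely, multiples of x and y have no such part.\<close>

lemma exact_0: "{p \<in> P 0. \<epsilon> p = 0} = \<delta> ` P 1"
proof (intro subset_antisym subsetI)
  fix p assume "p \<in> {p \<in> P 0. \<epsilon> p = 0}"
  then obtain v where v: "p = v \<otimes> single [] 1" "aug v = 0"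
    unfolding P_0 by (auto simp: \<epsilon>_tensor)
  obtain q r where "v = q \<odot> xy 1 0 + r \<odot> xy 0 1"
    using aug_eq_0[OF v(2)] .
  then have "p = \<delta> (q \<otimes> single [(1, 0)] 1 + r \<otimes> single [(0, 1)] 1)"
    by (simp only: v \<delta>_1)
  then show "p \<in> \<delta> ` P 1"
    unfolding P_1 by blast
next
  fix p assume "p \<in> \<delta> ` P 1"
  then obtain v w where "p = (v \<odot> xy 1 0 + w \<odot> xy 0 1) \<otimes> single [] 1"
    unfolding P_1 by (auto simp only: \<delta>_1)
  moreover have "aug (v \<odot> xy 1 0 + w \<odot> xy 0 1) = 0"
    by (simp only: lin_add[OF lin_coord_proj] aug_mult_xy) simp
  ultimately show "p \<in> {p \<in> P 0. \<epsilon> p = 0}"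
    unfolding P_0 by (auto simp: \<epsilon>_tensor)
qed

text \<open>A cycle is a pair (p, q) with p x + q y = 0, which \<open>mult_x_add_mult_y_eq_0\<close>
  identifies as (w u, - w s); the converse is u x = s y.\<close>

lemma exact_1: "{p \<in> P 1. \<delta> p = 0} = \<delta> ` P 2"
proof (intro subset_antisym subsetI)
  fix r assume "r \<in> {p \<in> P 1. \<delta> p = 0}"
  then obtain p q where r: "r = p \<otimes> single [(1, 0)] 1 + q \<otimes> single [(0, 1)] 1"
    and eq: "p \<odot> xy 1 0 + q \<odot> xy 0 1 = 0"
    unfolding P_1 using \<delta>_1 tensor_single_eq_0 by fastforce
  \<comment> \<open>A strict bound on the degrees occurring in \<open>p\<close>, as the syzygy lemma
    asks for one.\<close>
  obtain n where n: "\<forall>m\<in>(\<lambda>(i, j). i + j) ` keys p. m < n"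
    using finite_nat_set_iff_bounded[of "(\<lambda>(i, j). i + j) ` keys p"] by auto
  then have "p \<in> coord_space {(i, j). i + j < n}"
    by (auto simp: coord_space_def)
  then obtain w where "p = w \<odot> u" "q = - (w \<odot> s)"
    using mult_x_add_mult_y_eq_0 eq by blast
  then have "r = \<delta> (w \<otimes> single [(0, 1), (1, 0)] 1)"
    by (simp add: r \<delta>_2 lin_minus[OF lin_tensor_left])
  then show "r \<in> \<delta> ` P 2"
    unfolding P_2 by blast
next
  fix r assume "r \<in> \<delta> ` P 2"
  then obtain w where r: "r = (w \<odot> u) \<otimes> single [(1, 0)] 1 + (- (w \<odot> s)) \<otimes> single [(0, 1)] 1"
    unfolding P_2 by (auto simp: \<delta>_2 lin_minus[OF lin_tensor_left])
  have "w \<odot> u \<odot> xy 1 0 + (- (w \<odot> s)) \<odot> xy 0 1 = 0"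
    by (simp only: mult_minus mult_assoc u_mult_x) simp
  then have "\<delta> r = 0"
    unfolding r \<delta>_1 by (simp only: tensor_single_eq_0)
  then show "r \<in> {p \<in> P 1. \<delta> p = 0}"
    unfolding P_1 using r by blast
qed

text \<open>The coordinate of the image at the generator for x is w u, and right multiplication by
  \<open>u\<close> is injective.\<close>

lemma exact_2: "{p \<in> P 2. \<delta> p = 0} = {0}"
proof (intro subset_antisym subsetI)
  fix p assume "p \<in> {p \<in> P 2. \<delta> p = 0}"
  then obtain w where p: "p = w \<otimes> single [(0, 1), (1, 0)] 1" and "\<delta> p = 0"
    unfolding P_2 by blast
  then have eq: "(w \<odot> u) \<otimes> single [(1, 0) :: nat \<times> nat] 1 = (w \<odot> s) \<otimes> single [(0, 1) :: nat \<times> nat] (1::'k)"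
    by (simp add: \<delta>_2 del: One_nat_def)
  have "lookup (w \<odot> u) i = lookup ((w \<odot> u) \<otimes> single [(1, 0) :: nat \<times> nat] (1::'k)) (i, [(1, 0) :: nat \<times> nat])" for i
    by (simp add: lookup_tensor)
  also have "lookup ((w \<odot> u) \<otimes> single [(1, 0) :: nat \<times> nat] (1::'k)) (i, [(1, 0) :: nat \<times> nat]) = 0" for i
    by (simp add: eq lookup_tensor lookup_single del: One_nat_def)
  finally have "w \<odot> u = 0"
    by (intro poly_mapping_eqI) simp
  then have "w = 0"
    by (rule mult_u_eq_0)
  then show "p \<in> {0}"
    by (simp add: p lin_zero[OF lin_tensor_left])
qed (auto simp: coord_space_closed lin_zero[OF lin_free_ext])

lemma koszul_C: "koszul_algebra C"
proof -
  have exact: "{p \<in> P (Suc n). \<delta> p = 0} = \<delta> ` P (Suc (Suc n))" for n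
  proof -
    consider "n = 0" | "n = 1" | "n \<ge> 2"
      by linarith
    then show ?thesis
    proof cases
      case 1
      then show ?thesis
        using exact_1 by (simp add: numeral_2_eq_2)
    next
      case 2
      then show ?thesis
        using exact_2 P_ge_3[of 3] by (simp add: numeral_2_eq_2 numeral_3_eq_3 lin_zero[OF lin_free_ext])
    next
      case 3
      then have P: "P (Suc n) = {0}" "P (Suc (Suc n)) = {0}"
        by (intro P_ge_3; simp)+
      show ?thesis
        unfolding P by (auto simp: lin_zero[OF lin_free_ext])
    qed
  qed
  show ?thesis
    unfolding koszul_algebra_def Let_def
  \<comment> \<open>One map serves as every differential, since the length of a label tells its
    degree.\<close>
  proof (intro conjI connected_C exI[of _ labels] exI[of _ "\<lambda>_. \<delta>"] exI[of _ \<epsilon>] allI)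
    show "graded_module_hom (free_act C) (UNIV \<times> labels (Suc n)) (free_deg C (Suc n))
        (free_act C) (UNIV \<times> labels n) (free_deg C n) \<delta>" for n
      by (rule \<delta>_hom)
    show "graded_module_hom (free_act C) (UNIV \<times> labels 0) (free_deg C 0)
        (residue_act C) {i. gdeg C i = 0} (gdeg C) \<epsilon>"
      by (rule \<epsilon>_hom)
    show "\<epsilon> ` P 0 = homog (gdeg C) 0"
      by (rule \<epsilon>_P_0)
    show "{p \<in> P 0. \<epsilon> p = 0} = \<delta> ` P 1"
      by (rule exact_0)
    show "{p \<in> P (Suc n). \<delta> p = 0} = \<delta> ` P (Suc (Suc n))" for n
      by (rule exact)
  qed
qed

end

theorem theorem1p5:
  fixes A B :: "(nat, 'k::field) galg"
    and x y :: "nat \<Rightarrow>\<^sub>0 'k"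
    and \<tau> :: "(nat \<times> nat \<Rightarrow>\<^sub>0 'k) \<Rightarrow> (nat \<times> nat \<Rightarrow>\<^sub>0 'k)"
    and a b c :: 'k
  assumes "A = polynomial_algebra" and "x = indet"
    and "B = polynomial_algebra" and "y = indet"
    and "graded_twisting_map A B \<tau>"
    and "\<tau> (y \<otimes> x) = a *\<^sub>k (x ^ 2 \<otimes> 1) + b *\<^sub>k (x \<otimes> y) + 1 \<otimes> (c *\<^sub>k y ^ 2)"
    and "1 - a * c \<noteq> 0"
    and "b \<noteq> 0 \<or> c \<noteq> 0"
  shows "unique_extension_property A B \<tau> \<and>
         quadratic_algebra (twisted_tensor_product A B \<tau>) \<and>
         koszul_algebra (twisted_tensor_product A B \<tau>)"
proof -
  have sq: "(indet :: nat \<Rightarrow>\<^sub>0 'k) ^ 2 = single 2 1"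
    by (simp add: indet_def power2_eq_square mult_single numeral_2_eq_2)
  have one: "(1 :: nat \<Rightarrow>\<^sub>0 'k) = single 0 1"
    by simp
  \<comment> \<open>The hypothesis on \<tau>(y \<otimes> x), rewritten in the monomial basis, is the
    assumption of the locale.\<close>
  have "\<tau> (single (1, 1) 1) = a *\<^sub>k single (2, 0) 1 + b *\<^sub>k single (1, 1) 1 + c *\<^sub>k single (0, 2) 1"
    using assms(6) unfolding assms(2,4) sq one by (simp add: indet_def del: single_one)
  then interpret poly_twisting_relation \<tau> a b c
    using assms(1,3,5,7) by unfold_locales auto
  show ?thesis
    using unique_extension quadratic_C koszul_C by (simp add: assms(1,3))
qed

end
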